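(* Let $a,b\in\mathbb{Z}$ be integers such that for every prime $p$ one has $v_p(a)\le 2$ or $v_p(b)\le 3$, let $f(x)=x^3-ax+b$ be irreducible over $\mathbb{Q}$, let $\alpha$ be a root of $f$ and let $L=\mathbb{Q}(\alpha)$, a cubic number field. Put $\Delta=4a^3-27b^2$ (the discriminant of $f$) and $g=\gcd(a,b)$. Let $H$ be the unique Hopf-Galois structure on $L/\mathbb{Q}$. Then the $\mathbb{Z}$-order $\mathbb{Z}[\alpha]$ is free as a module over its associated order $\mathfrak{A}_H(\mathbb{Z}[\alpha])$ if and only if there exist integers $x,y\in\mathbb{Z}$ such that: 1. in the case $3\nmid a$: $x^2+3\Delta y^2=12ag$ or $x^2+3\Delta y^2=-12ag$; moreover $6a$ divides at least one of $9by+x$, $9by-x$; and $3\nmid y$. 2. in the case $3\mid a$ and $v_3(a)\le v_3(b)$: $x^2+3\Delta y^2=36ag$ or $x^2+3\Delta y^2=-36ag$; and $6a$ divides at least one of $9by+x$, $9by-x$. 3. in the case $v_3(a)>v_3(b)$: $x^2+3\Delta y^2=108ag$ or $x^2+3\Delta y^2=-108ag$; and $6a$ divides at least one of $9by+x$, $9by-x$.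
   Context: $v_p$ is the $p$-adic valuation, with $v_p(0)=\infty$; $0$ divides only $0$. A Hopf-Galois structure on a number field $L$ is a finite-dimensional cocommutative $\mathbb{Q}$-Hopf algebra $H$ with a $\mathbb{Q}$-linear action $\cdot\colon H\otimes_{\mathbb{Q}}L\to L$ making $L$ an $H$-module algebra and such that $L\otimes_{\mathbb{Q}}H\to\mathrm{End}_{\mathbb{Q}}(L)$, $x\otimes h\mapsto (y\mapsto x(h\cdot y))$, is a $\mathbb{Q}$-linear isomorphism. Every cubic number field has exactly one Hopf-Galois structure (up to isomorphism). Concretely: let $\widetilde{L}$ be the normal closure of $L$, $G=\mathrm{Gal}(\widetilde L/\mathbb{Q})$, $G'=\mathrm{Gal}(\widetilde{L}/L)$, $\alpha_1=\alpha,\alpha_2,\alpha_3\in\widetilde L$ the roots of $f$, $\sigma\in G$ the element acting on them as the cycle $(\alpha_1,\alpha_2,\alpha_3)$, $J=\langle\sigma\rangle$, $M=\mathbb{Q}(\sqrt{\Delta})\subseteq\widetilde L$. Then $H=M[J]^{G'}$, where $G'$ acts on $M$ by Galois action and on $J$ by conjugation, and $h=\sum_i h_i\sigma^i\in H$ acts on $x\in L$ by $h\cdot x=\sum_i h_i\sigma^i(x)$. (If $L/\mathbb{Q}$ is Galois, $H=\mathbb{Q}[G]$ with its usual action.) A $\mathbb{Z}$-order in $L$ is a unital subring that is finitely generated over $\mathbb{Z}$ and contains a $\mathbb{Q}$-basis of $L$. The associated order of a $\mathbb{Z}$-order $\mathcal{O}$ in $H$ is $\mathfrak{A}_H(\mathcal{O})=\{h\in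 H\mid h\cdot\mathcal{O}\subseteq\mathcal{O}\}$; it is a $\mathbb{Z}$-order in $H$ acting on $\mathcal{O}$. *)

theory Defs
  imports
    "HOL-Computational_Algebra.Computational_Algebra"
    "HOL-Library.Extended_Nat"
    "HOL-Algebra.Module"
begin

section \<open>Valuations, cubic polynomials, number fields generated by one element\<close>

text \<open>The library's \<^const>\<open>multiplicity\<close> is 0 at 0, so the value \<open>\<infinity>\<close> has to be added.\<close>

definition pval :: "int \<Rightarrow> int \<Rightarrow> enat" where
  "pval p n = (if n = 0 then \<infinity> else enat (multiplicity p n))"

definition cubic :: "int \<Rightarrow> int \<Rightarrow> int poly" where
  "cubic a b = [:b, - a, 0, 1:]"

definition rat_adjoin :: "'k::field_char_0 \<Rightarrow> 'k set" where
  "rat_adjoin \<alpha> =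
     {poly (map_poly of_rat p) \<alpha> / poly (map_poly of_rat q) \<alpha> | (p :: rat poly) (q :: rat poly).
        poly (map_poly of_rat q) \<alpha> \<noteq> 0}"

definition int_adjoin :: "'k::field_char_0 \<Rightarrow> 'k set" where
  "int_adjoin \<alpha> = {poly (map_poly of_int p) \<alpha> | p :: int poly. True}"

definition rat_ring :: "rat ring" where
  "rat_ring = \<lparr>carrier = UNIV, mult = (*), one = 1, zero = 0, add = (+)\<rparr>"

text \<open>A subfield \<open>L\<close> of a field of characteristic 0 as a \<open>\<rat>\<close>-algebra.\<close>

definition field_alg :: "'k::field_char_0 set \<Rightarrow> (rat, 'k) module" where
  "field_alg L = \<lparr>carrier = L, mult = (*), one = 1, zero = 0, add = (+),
                  smult = (\<lambda>c x. of_rat c * x)\<rparr>"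


section \<open>Tensor products over the rationals\<close>

text \<open>
  An element of \<open>V \<otimes> W\<close> is represented by a formal sum of simple tensors: the list
  \<open>[(v\<^sub>1,w\<^sub>1),\<dots>,(v\<^sub>n,w\<^sub>n)]\<close> stands for \<open>v\<^sub>1 \<otimes> w\<^sub>1 + \<dots> + v\<^sub>n \<otimes> w\<^sub>n\<close> and concatenation is addition.
  Two formal sums denote the same tensor iff they are identified by the congruence generated
  by the (bi- or tri-)linearity relations, which is the usual construction of the tensor product
  as a quotient.  No generators for additive inverses are needed:
  \<open>(v,w)\<close> and \<open>(-v,w)\<close> add up to \<open>(0,w)\<close>, which is identified with the empty sum.
\<close>

inductive fsum_cong :: "('t list \<Rightarrow> 't list \<Rightarrow> bool) \<Rightarrow> 't list \<Rightarrow> 't list \<Rightarrow> bool" for R where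
  gen: "R u v \<Longrightarrow> fsum_cong R u v"
| refl: "fsum_cong R u u"
| sym: "fsum_cong R u v \<Longrightarrow> fsum_cong R v u"
| trans: "fsum_cong R u v \<Longrightarrow> fsum_cong R v w \<Longrightarrow> fsum_cong R u w"
| comm: "fsum_cong R (u @ v) (v @ u)"
| add: "fsum_cong R u v \<Longrightarrow> fsum_cong R (u @ w) (v @ w)"

inductive bilin_rel ::
  "(rat, 'v, 'm) module_scheme \<Rightarrow> (rat, 'w, 'n) module_scheme \<Rightarrow>
   ('v \<times> 'w) list \<Rightarrow> ('v \<times> 'w) list \<Rightarrow> bool" for V W where
  add1: "\<lbrakk>x \<in> carrier V; x' \<in> carrier V; y \<in> carrier W\<rbrakk>
         \<Longrightarrow> bilin_rel V W [(x \<oplus>\<^bsub>V\<^esub> x', y)] [(x, y), (x', y)]"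
| add2: "\<lbrakk>x \<in> carrier V; y \<in> carrier W; y' \<in> carrier W\<rbrakk>
         \<Longrightarrow> bilin_rel V W [(x, y \<oplus>\<^bsub>W\<^esub> y')] [(x, y), (x, y')]"
| zero: "y \<in> carrier W \<Longrightarrow> bilin_rel V W [(\<zero>\<^bsub>V\<^esub>, y)] []"
| smult: "\<lbrakk>x \<in> carrier V; y \<in> carrier W\<rbrakk>
         \<Longrightarrow> bilin_rel V W [(c \<odot>\<^bsub>V\<^esub> x, y)] [(x, c \<odot>\<^bsub>W\<^esub> y)]"

inductive trilin_rel ::
  "(rat, 'v, 'm) module_scheme \<Rightarrow>
   ('v \<times> 'v \<times> 'v) list \<Rightarrow> ('v \<times> 'v \<times> 'v) list \<Rightarrow> bool" for V where
  add1: "\<lbrakk>x \<in> carrier V; x' \<in> carrier V; y \<in> carrier V; z \<in> carrier V\<rbrakk>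
         \<Longrightarrow> trilin_rel V [(x \<oplus>\<^bsub>V\<^esub> x', y, z)] [(x, y, z), (x', y, z)]"
| add2: "\<lbrakk>x \<in> carrier V; y \<in> carrier V; y' \<in> carrier V; z \<in> carrier V\<rbrakk>
         \<Longrightarrow> trilin_rel V [(x, y \<oplus>\<^bsub>V\<^esub> y', z)] [(x, y, z), (x, y', z)]"
| add3: "\<lbrakk>x \<in> carrier V; y \<in> carrier V; z \<in> carrier V; z' \<in> carrier V\<rbrakk>
         \<Longrightarrow> trilin_rel V [(x, y, z \<oplus>\<^bsub>V\<^esub> z')] [(x, y, z), (x, y, z')]"
| zero: "\<lbrakk>y \<in> carrier V; z \<in> carrier V\<rbrakk> \<Longrightarrow> trilin_rel V [(\<zero>\<^bsub>V\<^esub>, y, z)] []"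
| smult2: "\<lbrakk>x \<in> carrier V; y \<in> carrier V; z \<in> carrier V\<rbrakk>
         \<Longrightarrow> trilin_rel V [(c \<odot>\<^bsub>V\<^esub> x, y, z)] [(x, c \<odot>\<^bsub>V\<^esub> y, z)]"
| smult3: "\<lbrakk>x \<in> carrier V; y \<in> carrier V; z \<in> carrier V\<rbrakk>
         \<Longrightarrow> trilin_rel V [(c \<odot>\<^bsub>V\<^esub> x, y, z)] [(x, y, c \<odot>\<^bsub>V\<^esub> z)]"

definition tensors ::
  "(rat, 'v, 'm) module_scheme \<Rightarrow> (rat, 'w, 'n) module_scheme \<Rightarrow> ('v \<times> 'w) list set" where
  "tensors V W = lists (carrier V \<times> carrier W)"

abbreviation tensor_eq ::
  "(rat, 'v, 'm) module_scheme \<Rightarrow> (rat, 'w, 'n) module_scheme \<Rightarrow>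
   ('v \<times> 'w) list \<Rightarrow> ('v \<times> 'w) list \<Rightarrow> bool" where
  "tensor_eq V W \<equiv> fsum_cong (bilin_rel V W)"

abbreviation tensor3_eq ::
  "(rat, 'v, 'm) module_scheme \<Rightarrow>
   ('v \<times> 'v \<times> 'v) list \<Rightarrow> ('v \<times> 'v \<times> 'v) list \<Rightarrow> bool" where
  "tensor3_eq V \<equiv> fsum_cong (trilin_rel V)"

definition list_sum :: "('a, 'm) ring_scheme \<Rightarrow> 'a list \<Rightarrow> 'a" where
  "list_sum H xs = foldr (add H) xs \<zero>\<^bsub>H\<^esub>"


section \<open>Finite-dimensional cocommutative Hopf algebras over the rationals\<close>

record 'h hopf = "(rat, 'h) module" +
  comult :: "'h \<Rightarrow> ('h \<times> 'h) list"
  counit :: "'h \<Rightarrow> rat"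
  antipode :: "'h \<Rightarrow> 'h"

locale rat_algebra = ring H + V: module rat_ring H for H (structure) +
  assumes smult_mult_left:
    "\<lbrakk>x \<in> carrier H; y \<in> carrier H\<rbrakk> \<Longrightarrow> (c \<odot> x) \<otimes> y = c \<odot> (x \<otimes> y)"
  and smult_mult_right:
    "\<lbrakk>x \<in> carrier H; y \<in> carrier H\<rbrakk> \<Longrightarrow> x \<otimes> (c \<odot> y) = c \<odot> (x \<otimes> y)"

locale fd_cocomm_hopf_algebra = rat_algebra H
  for H :: "('h, 'm) hopf_scheme" (structure) +
  assumes finite_dim:
    "\<exists>B. finite B \<and> B \<subseteq> carrier H \<and>
       (\<forall>x \<in> carrier H. \<exists>c. x = (\<Oplus>b\<in>B. c b \<odot> b))"
  and comult_closed: "x \<in> carrier H \<Longrightarrow> comult H x \<in> tensors H H"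
  and comult_add: "\<lbrakk>x \<in> carrier H; y \<in> carrier H\<rbrakk> \<Longrightarrow>
       tensor_eq H H (comult H (x \<oplus> y)) (comult H x @ comult H y)"
  and comult_smult: "x \<in> carrier H \<Longrightarrow>
       tensor_eq H H (comult H (c \<odot> x)) [(c \<odot> x1, x2). (x1, x2) \<leftarrow> comult H x]"
  and comult_mult: "\<lbrakk>x \<in> carrier H; y \<in> carrier H\<rbrakk> \<Longrightarrow>
       tensor_eq H H (comult H (x \<otimes> y))
         [(x1 \<otimes> y1, x2 \<otimes> y2). (x1, x2) \<leftarrow> comult H x, (y1, y2) \<leftarrow> comult H y]"
  and comult_one: "tensor_eq H H (comult H \<one>) [(\<one>, \<one>)]"
  and counit_add: "\<lbrakk>x \<in> carrier H; y \<in> carrier H\<rbrakk> \<Longrightarrow>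
       counit H (x \<oplus> y) = counit H x + counit H y"
  and counit_smult: "x \<in> carrier H \<Longrightarrow> counit H (c \<odot> x) = c * counit H x"
  and counit_mult: "\<lbrakk>x \<in> carrier H; y \<in> carrier H\<rbrakk> \<Longrightarrow>
       counit H (x \<otimes> y) = counit H x * counit H y"
  and counit_one: "counit H \<one> = 1"
  and antipode_closed: "x \<in> carrier H \<Longrightarrow> antipode H x \<in> carrier H"
  and antipode_add: "\<lbrakk>x \<in> carrier H; y \<in> carrier H\<rbrakk> \<Longrightarrow>
       antipode H (x \<oplus> y) = antipode H x \<oplus> antipode H y"
  and antipode_smult: "x \<in> carrier H \<Longrightarrow> antipode H (c \<odot> x) = c \<odot> antipode H x"
  and coassoc: "x \<in> carrier H \<Longrightarrow>
       tensor3_eq H [(u, v, x2). (x1, x2) \<leftarrow> comult H x, (u, v) \<leftarrow> comult H x1]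
                    [(x1, u, v). (x1, x2) \<leftarrow> comult H x, (u, v) \<leftarrow> comult H x2]"
  and counit_left: "x \<in> carrier H \<Longrightarrow>
       list_sum H [counit H x1 \<odot> x2. (x1, x2) \<leftarrow> comult H x] = x"
  and counit_right: "x \<in> carrier H \<Longrightarrow>
       list_sum H [counit H x2 \<odot> x1. (x1, x2) \<leftarrow> comult H x] = x"
  and antipode_left: "x \<in> carrier H \<Longrightarrow>
       list_sum H [antipode H x1 \<otimes> x2. (x1, x2) \<leftarrow> comult H x] = counit H x \<odot> \<one>"
  and antipode_right: "x \<in> carrier H \<Longrightarrow>
       list_sum H [x1 \<otimes> antipode H x2. (x1, x2) \<leftarrow> comult H x] = counit H x \<odot> \<one>"
  and cocomm: "x \<in> carrier H \<Longrightarrow>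
       tensor_eq H H [(x2, x1). (x1, x2) \<leftarrow> comult H x] (comult H x)"


section \<open>Hopf-Galois structures\<close>

text \<open>The \<open>\<rat>\<close>-linear endomorphisms of \<open>L\<close>; only their values on \<open>L\<close> matter.\<close>

definition rat_endos :: "'k::field_char_0 set \<Rightarrow> ('k \<Rightarrow> 'k) set" where
  "rat_endos L = {\<phi>. (\<forall>y\<in>L. \<phi> y \<in> L) \<and> (\<forall>y\<in>L. \<forall>z\<in>L. \<phi> (y + z) = \<phi> y + \<phi> z) \<and>
                     (\<forall>c. \<forall>y\<in>L. \<phi> (of_rat c * y) = of_rat c * \<phi> y)}"

text \<open>The endomorphism \<open>y \<mapsto> x (h \<cdot> y)\<close> attached to \<open>x \<otimes> h\<close>, extended additively.\<close>

definition galois_map :: "('h \<Rightarrow> 'k \<Rightarrow> 'k) \<Rightarrow> ('k \<times> 'h) list \<Rightarrow> 'k::field_char_0 \<Rightarrow> 'k" where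
  "galois_map act u y = (\<Sum>(x, h)\<leftarrow>u. x * act h y)"

locale hopf_galois_structure = fd_cocomm_hopf_algebra H
  for L :: "'k::field_char_0 set"
  and H :: "('h, 'm) hopf_scheme" (structure)
  and act :: "'h \<Rightarrow> 'k \<Rightarrow> 'k" +
  assumes act_closed: "\<lbrakk>h \<in> carrier H; y \<in> L\<rbrakk> \<Longrightarrow> act h y \<in> L"
  and act_add_left: "\<lbrakk>h \<in> carrier H; h' \<in> carrier H; y \<in> L\<rbrakk> \<Longrightarrow>
       act (h \<oplus> h') y = act h y + act h' y"
  and act_smult_left: "\<lbrakk>h \<in> carrier H; y \<in> L\<rbrakk> \<Longrightarrow> act (c \<odot> h) y = of_rat c * act h y"
  and act_endo: "h \<in> carrier H \<Longrightarrow> act h \<in> rat_endos L"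
  and act_one: "y \<in> L \<Longrightarrow> act \<one> y = y"
  and act_mult: "\<lbrakk>h \<in> carrier H; h' \<in> carrier H; y \<in> L\<rbrakk> \<Longrightarrow>
       act (h \<otimes> h') y = act h (act h' y)"
  and act_alg_mult: "\<lbrakk>h \<in> carrier H; y \<in> L; z \<in> L\<rbrakk> \<Longrightarrow>
       act h (y * z) = (\<Sum>(h1, h2)\<leftarrow>comult H h. act h1 y * act h2 z)"
  and act_alg_one: "h \<in> carrier H \<Longrightarrow> act h 1 = of_rat (counit H h)"
  \<comment> \<open>\<open>L \<otimes> H \<rightarrow> End(L)\<close> is bijective\<close>
  and galois_inj: "\<lbrakk>u \<in> tensors (field_alg L) H; v \<in> tensors (field_alg L) H;
       \<And>y. y \<in> L \<Longrightarrow> galois_map act u y = galois_map act v y\<rbrakk> \<Longrightarrow>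
       tensor_eq (field_alg L) H u v"
  and galois_surj: "\<phi> \<in> rat_endos L \<Longrightarrow>
       \<exists>u \<in> tensors (field_alg L) H. \<forall>y\<in>L. galois_map act u y = \<phi> y"

definition assoc_order ::
  "('h, 'm) hopf_scheme \<Rightarrow> ('h \<Rightarrow> 'k \<Rightarrow> 'k) \<Rightarrow> 'k set \<Rightarrow> 'h set" where
  "assoc_order H act R = {h \<in> carrier H. \<forall>x\<in>R. act h x \<in> R}"

text \<open>
  \<open>M\<close> is free over the subring \<open>A\<close> of \<open>H\<close> if it has an \<open>A\<close>-basis \<open>B\<close>, of any cardinality.
\<close>

definition free_over ::
  "('h, 'm) hopf_scheme \<Rightarrow> ('h \<Rightarrow> 'k \<Rightarrow> 'k) \<Rightarrow> 'h set \<Rightarrow> 'k::field_char_0 set \<Rightarrow> bool" where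
  "free_over H act A M \<longleftrightarrow> (\<exists>B \<subseteq> M.
     (\<forall>m\<in>M. \<exists>F c. finite F \<and> F \<subseteq> B \<and> c ` F \<subseteq> A \<and> m = (\<Sum>b\<in>F. act (c b) b)) \<and>
     (\<forall>F c. finite F \<and> F \<subseteq> B \<and> c ` F \<subseteq> A \<and> (\<Sum>b\<in>F. act (c b) b) = 0 \<longrightarrow>
        (\<forall>b\<in>F. c b = \<zero>\<^bsub>H\<^esub>)))"

end

theory Submission
  imports
    Defs
    "HOL-Computational_Algebra.Field_as_Ring"
    "HOL-Computational_Algebra.Fundamental_Theorem_Algebra"
begin

text \<open>
  Over \<open>\<complex>\<close> the Galois map makes \<open>\<complex> \<otimes> H\<close> the span of three group-like elements, which permute the
  complex embeddings of \<open>L\<close> and form a cyclic group of order 3. So \<open>H\<close> acts on \<open>L\<close> through circulant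
  matrices, and rationality shows that its elements act as scalars on \<open>1\<close> and as \<open>x + y R\<close> on the
  elements of trace \<open>0\<close>, with \<open>x\<close>, \<open>y\<close> rational and
  \<open>R \<alpha> = 6 a \<alpha>\<^sup>2 + 9 b \<alpha> - 4 a\<^sup>2\<close>, \<open>R\<^sup>2 = -3 \<Delta>\<close>.

  The associated order is then an explicit lattice, and \<open>\<theta> = u + v \<alpha> + w \<alpha>\<^sup>2\<close>
      is a free generator iff
  the determinant of \<open>h \<mapsto> h \<cdot> \<theta>\<close> is \<open>\<plusminus>1\<close>. Up to constants this determinant is
  \<open>(3 u + 2 a w) (3 a v\<^sup>2 - 9 b v w + a\<^sup>2 w\<^sup>2)\<close>; completing the square in the second factor with
  \<open>x = 6 a v - 9 b w\<close>, \<open>y = w\<close> gives the norm form \<open>x\<^sup>2 + 3 \<Delta> y\<^sup>2\<close>.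
\<close>

section \<open>The cubic field and its power basis\<close>

text \<open>\<open>H\<close> is given only by axioms, so its shape has to be extracted from the
  Galois map, and the two halves of bijectivity do different work. Following the Galois map by one
  complex embedding identifies \<complex> \<otimes> H with the \<rat>-linear maps from L to
  \<complex>, where the three embeddings form a basis; the group-like elements are their preimages.
  Embeddings being multiplicative, the module-algebra axiom becomes orthogonality of matrix entries.
  Surjectivity makes each row of the matrices of \<open>H\<close> span \<complex>^3, so the axioms
  of \<open>H\<close> pass to the group-likes; injectivity shows that one row determines the matrix
  and that the action is faithful. The way back to \<rat> applies the retraction
  \<open>coord 0\<close> to the coefficients of tensors. The lattice has denominator n, the gcd of
  18 b, 6 a and 2 a^2. It equals 2 \<kappa> g with \<kappa> = 1, 3, 9 in the three cases, whence the
  constants 12, 36, 108. The linear factor of the determinant contributes only the condition that 3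
  does not divide y. For a = 0 the norm form degenerates, so that case is settled by itself.\<close>

lemma map_poly_pCons_zero:
  assumes "f 0 = 0"
  shows "map_poly f (pCons c p) = pCons (f c) (map_poly f p)"
  by (cases "c = 0 \<and> p = 0") (auto simp: assms map_poly_pCons)

lemma poly_of_rat_pCons:
  "poly (map_poly of_rat (pCons c p)) x = of_rat c +
      x * poly (map_poly of_rat p) (x::'a::field_char_0)"
  by (simp add: map_poly_pCons_zero)

lemma poly_of_int_pCons:
  "poly (map_poly of_int (pCons c p)) x = of_int c +
      x * poly (map_poly of_int p) (x::'a::comm_ring_1)"
  by (simp add: map_poly_pCons_zero)

lemma poly_of_rat_add:
  "poly (map_poly of_rat (p + q)) x = poly (map_poly of_rat p) x +
      poly (map_poly of_rat q) (x::'a::field_char_0)"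
proof (induction p arbitrary: q)
  case (pCons c p)
  obtain d r where "q = pCons d r" by (cases q) auto
  then show ?case by (simp add: poly_of_rat_pCons pCons.IH of_rat_add algebra_simps)
qed simp

lemma poly_of_rat_smult:
  "poly (map_poly of_rat (Polynomial.smult c q)) x =
      of_rat c * poly (map_poly of_rat q) (x::'a::field_char_0)"
  by (induction q) (simp_all add: poly_of_rat_pCons of_rat_mult algebra_simps)

lemma poly_of_rat_mult:
  "poly (map_poly of_rat (p * q)) x =
      poly (map_poly of_rat p) x * poly (map_poly of_rat q) (x::'a::field_char_0)"
  by (induction p)
    (simp_all add: poly_of_rat_pCons poly_of_rat_add poly_of_rat_smult mult_pCons_left
        algebra_simps)

text \<open>Stated for a root in any field of characteristic 0, so that one multiplication table
  serves \<alpha> and its complex images alike.\<close>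

lemma cubic_relation_mult:
  fixes z :: "'a::field_char_0"
  assumes "z ^ 3 = A * z - B"
  shows "(c0 + c1 * z + c2 * z ^ 2) * (d0 + d1 * z + d2 * z ^ 2) =
    (c0 * d0 - B * (c1 * d2 + c2 * d1)) +
    (c0 * d1 + c1 * d0 + A * (c1 * d2 + c2 * d1) - B * (c2 * d2)) * z +
    (c0 * d2 + c1 * d1 + c2 * d0 + A * (c2 * d2)) * z ^ 2"
  using assms by Groebner_Basis.algebra

locale cubic_number_field =
  fixes a b :: int and \<alpha> :: "'k::field_char_0"
  assumes irr: "irreducible (map_poly of_int (cubic a b) :: rat poly)"
    and root: "poly (map_poly of_int (cubic a b)) \<alpha> = 0"
begin

abbreviation L :: "'k set" where "L \<equiv> rat_adjoin \<alpha>"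

definition disc :: int where "disc = 4 * a ^ 3 - 27 * b ^ 2"

lemma cubic_rat: "map_poly of_int (cubic a b) =
    ([:of_int b, - of_int a, 0, 1:] :: 'a::field_char_0 poly)"
  by (simp add: cubic_def map_poly_pCons_zero)

lemma root_cube: "\<alpha> ^ 3 = of_int a * \<alpha> - of_int b"
proof -
  have "of_int b + \<alpha> * (\<alpha> * \<alpha> - of_int a) = 0"
    using root unfolding cubic_rat by (simp add: algebra_simps)
  then show ?thesis by (simp add: power3_eq_cube algebra_simps add_eq_0_iff)
qed

lemma no_rat_root: "c ^ 3 - of_int a * c + of_int b \<noteq> (0::rat)"
proof
  assume "c ^ 3 - of_int a * c + of_int b = 0"
  then have "poly (map_poly of_int (cubic a b)) c = 0"
    unfolding cubic_rat by (simp add: algebra_simps power3_eq_cube)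
  then obtain q where q: "map_poly of_int (cubic a b) = [:- c, 1:] * q"
    by (auto simp: poly_eq_0_iff_dvd dvd_def)
  have deg: "degree (map_poly of_int (cubic a b) :: rat poly) = 3"
    unfolding cubic_rat by simp
  have "q \<noteq> 0" using q deg by auto
  then have "degree ([:- c, 1:] * q) = 1 + degree q"
    by (subst degree_mult_eq) auto
  then have "degree q = 2" using q deg by simp
  moreover have "is_unit [:- c, 1:] \<or> is_unit q"
    using irr q by (metis irreducibleD)
  ultimately show False by (auto simp: is_unit_iff_degree \<open>q \<noteq> 0\<close>)
qed

lemma b_nonzero: "b \<noteq> 0"
  using no_rat_root[of 0] by auto

text \<open>A zero discriminant would make 3b/(2a) a rational double root. The distinctness of the
  complex roots and the elimination in \<open>op_surj\<close> rest on this.\<close>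

lemma disc_nonzero: "disc \<noteq> 0"
proof
  assume d: "disc = 0"
  then have "a \<noteq> 0" using b_nonzero by (auto simp: disc_def)
  define A B :: rat where "A = of_int a" and "B = of_int b"
  have "4 * A ^ 3 = 27 * B ^ 2"
  proof -
    have "of_int (4 * a ^ 3) = (of_int (27 * b ^ 2) :: rat)"
      using d unfolding disc_def by simp
    then show ?thesis by (simp add: A_def B_def)
  qed
  moreover have "A \<noteq> 0" using \<open>a \<noteq> 0\<close> by (simp add: A_def)
  moreover from this have "(3 * B / (2 * A)) ^ 3 - A * (3 * B / (2 * A)) + B =
      (27 * B ^ 2 - 4 * A ^ 3) * B / (8 * A ^ 3)"
    by (simp add: power3_eq_cube power2_eq_square field_simps)
  ultimately have "(3 * B / (2 * A)) ^ 3 - A * (3 * B / (2 * A)) + B = 0" by simp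
  then show False using no_rat_root unfolding A_def B_def by blast
qed

text \<open>Bezout in \<rat>[X] against the irreducible cubic. It makes the quotients in
  \<open>rat_adjoin\<close> polynomial in \<alpha> and yields the independence of 1, \<alpha>,
  \<alpha>^2.\<close>

lemma rat_poly_inverse:
  assumes "\<not> map_poly of_int (cubic a b) dvd (q :: rat poly)"
  shows "\<exists>t. poly (map_poly of_rat t) \<alpha> * poly (map_poly of_rat q) \<alpha> = 1"
proof -
  let ?f = "map_poly of_int (cubic a b) :: rat poly"
  have "prime_elem ?f" using irr by (rule irreducible_imp_prime_elem)
  then have "coprime ?f q" using assms by (rule prime_elem_imp_coprime)
  then obtain s t where st: "s * ?f + t * q = 1"
    by (metis bezout_coefficients_fst_snd coprime_imp_gcd_eq_1)
  have "poly (map_poly of_rat ?f) \<alpha> = 0"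
    using root unfolding cubic_rat by (simp add: map_poly_pCons_zero of_rat_minus)
  moreover have "poly (map_poly of_rat (s * ?f + t * q)) \<alpha> = 1"
    unfolding st by simp
  ultimately show ?thesis by (auto simp: poly_of_rat_add poly_of_rat_mult)
qed

definition elt :: "rat \<Rightarrow> rat \<Rightarrow> rat \<Rightarrow> 'k" where
  "elt c0 c1 c2 = of_rat c0 + of_rat c1 * \<alpha> + of_rat c2 * \<alpha> ^ 2"

lemma elt_eq_0:
  assumes "elt c0 c1 c2 = 0"
  shows "c0 = 0 \<and> c1 = 0 \<and> c2 = 0"
proof (rule ccontr)
  assume nz: "\<not> (c0 = 0 \<and> c1 = 0 \<and> c2 = 0)"
  let ?q = "[:c0, c1, c2:]"
  have z: "poly (map_poly of_rat ?q) \<alpha> = 0"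
    using assms by (simp add: elt_def poly_of_rat_pCons algebra_simps power2_eq_square)
  have "\<not> map_poly of_int (cubic a b) dvd ?q"
  proof
    assume "map_poly of_int (cubic a b) dvd ?q"
    then have "degree (map_poly of_int (cubic a b) :: rat poly) \<le> degree ?q"
      using nz by (intro dvd_imp_degree_le) auto
    moreover have "degree ?q \<le> 2" by simp
    ultimately show False unfolding cubic_rat by simp
  qed
  then show False using rat_poly_inverse[of ?q] z by simp
qed

lemma elt_add: "elt c0 c1 c2 + elt d0 d1 d2 = elt (c0 + d0) (c1 + d1) (c2 + d2)"
  by (simp add: elt_def of_rat_add algebra_simps)

lemma elt_diff: "elt c0 c1 c2 - elt d0 d1 d2 = elt (c0 - d0) (c1 - d1) (c2 - d2)"
  by (simp add: elt_def of_rat_diff algebra_simps)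

lemma elt_scale: "of_rat c * elt d0 d1 d2 = elt (c * d0) (c * d1) (c * d2)"
  by (simp add: elt_def of_rat_mult algebra_simps)

lemma elt_mult:
  "elt c0 c1 c2 * elt d0 d1 d2 =
    elt (c0 * d0 - of_int b * (c1 * d2 + c2 * d1))
        (c0 * d1 + c1 * d0 + of_int a * (c1 * d2 + c2 * d1) - of_int b * (c2 * d2))
        (c0 * d2 + c1 * d1 + c2 * d0 + of_int a * (c2 * d2))"
  unfolding elt_def of_rat_add of_rat_diff of_rat_mult of_rat_of_int_eq
  by (rule cubic_relation_mult[OF root_cube])

lemma elt_inject: "elt c0 c1 c2 = elt d0 d1 d2 \<longleftrightarrow> c0 = d0 \<and> c1 = d1 \<and> c2 = d2"
  using elt_eq_0[of "c0 - d0" "c1 - d1" "c2 - d2"] elt_diff[of c0 c1 c2 d0 d1 d2] by auto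

lemma elt_simps: "elt 0 0 0 = 0" "elt 1 0 0 = 1" "elt 0 1 0 = \<alpha>" "elt 0 0 1 = \<alpha> ^ 2" "elt c 0 0 =
    of_rat c"
  by (simp_all add: elt_def)

lemma poly_rat_elt: "\<exists>c0 c1 c2. poly (map_poly of_rat p) \<alpha> = elt c0 c1 c2"
proof (induction p)
  case 0
  then show ?case by (metis elt_simps(1) map_poly_0 poly_0)
next
  case (pCons c p)
  then obtain c0 c1 c2 where "poly (map_poly of_rat p) \<alpha> = elt c0 c1 c2" by blast
  then have "poly (map_poly of_rat (pCons c p)) \<alpha> = elt c 0 0 + elt 0 1 0 * elt c0 c1 c2"
    by (simp add: poly_of_rat_pCons elt_simps)
  then show ?case unfolding elt_mult elt_add by blast
qed

lemma poly_int_elt: "\<exists>c0 c1 c2 :: int. poly (map_poly of_int p) \<alpha> =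
    elt (of_int c0) (of_int c1) (of_int c2)"
proof (induction p)
  case 0
  have "poly (map_poly of_int (0::int poly)) \<alpha> = elt (of_int 0) (of_int 0) (of_int 0)"
    by (simp add: elt_simps)
  then show ?case by blast
next
  case (pCons c p)
  then obtain c0 c1 c2 :: int where "poly (map_poly of_int p) \<alpha> =
      elt (of_int c0) (of_int c1) (of_int c2)" by blast
  then have "poly (map_poly of_int (pCons c p)) \<alpha> =
      elt (of_int c) 0 0 + elt 0 1 0 * elt (of_int c0) (of_int c1) (of_int c2)"
    by (simp add: poly_of_int_pCons elt_simps)
  also have "\<dots> = elt (of_int (c - b * c2)) (of_int (c0 + a * c2)) (of_int c1)"
    unfolding elt_mult elt_add by simp
  finally show ?case by blast
qed

lemma elt_in_L [simp]: "elt c0 c1 c2 \<in> L"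
proof -
  have "elt c0 c1 c2 = poly (map_poly of_rat [:c0, c1, c2:]) \<alpha> / poly (map_poly of_rat 1) \<alpha>"
    by (simp add: elt_def poly_of_rat_pCons algebra_simps power2_eq_square)
  moreover have "poly (map_poly of_rat 1) \<alpha> \<noteq> 0" by simp
  ultimately show ?thesis unfolding rat_adjoin_def by blast
qed

lemma L_eq: "L = {elt c0 c1 c2 | c0 c1 c2. True}"
proof
  show "L \<subseteq> {elt c0 c1 c2 | c0 c1 c2. True}"
  proof
    fix y assume "y \<in> L"
    then obtain p q :: "rat poly" where y: "y =
        poly (map_poly of_rat p) \<alpha> / poly (map_poly of_rat q) \<alpha>"
      and q: "poly (map_poly of_rat q) \<alpha> \<noteq> 0" unfolding rat_adjoin_def by blast
    have "\<not> map_poly of_int (cubic a b) dvd q"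
    proof
      assume "map_poly of_int (cubic a b) dvd q"
      then obtain r where r: "q = map_poly of_int (cubic a b) * r" by (auto simp: dvd_def)
      have "poly (map_poly of_rat (map_poly of_int (cubic a b))) \<alpha> = 0"
        using root unfolding cubic_rat by (simp add: map_poly_pCons_zero of_rat_minus)
      then show False using q unfolding r poly_of_rat_mult by simp
    qed
    from rat_poly_inverse[OF this] obtain t where
      "poly (map_poly of_rat t) \<alpha> * poly (map_poly of_rat q) \<alpha> = 1" by blast
    then have "y = poly (map_poly of_rat (p * t)) \<alpha>"
      using q unfolding y poly_of_rat_mult by (simp add: divide_eq_eq mult.assoc)
    then show "y \<in> {elt c0 c1 c2 | c0 c1 c2. True}" using poly_rat_elt[of "p * t"] by auto
  qed
qed auto

lemma L_cases:
  assumes "y \<in> L"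
  obtains c0 c1 c2 where "y = elt c0 c1 c2"
  using assms unfolding L_eq by blast

lemma int_adjoin_eq:
  "int_adjoin \<alpha> = {elt (of_int c0) (of_int c1) (of_int c2) | c0 c1 c2. True}"
proof
  show "int_adjoin \<alpha> \<subseteq> {elt (of_int c0) (of_int c1) (of_int c2) | c0 c1 c2. True}"
    unfolding int_adjoin_def using poly_int_elt by blast
  have "elt (of_int c0) (of_int c1) (of_int c2) = poly (map_poly of_int [:c0, c1, c2:]) \<alpha>"
    for c0 c1 c2
    by (simp add: elt_def poly_of_int_pCons algebra_simps power2_eq_square)
  then show "{elt (of_int c0) (of_int c1) (of_int c2) | c0 c1 c2. True} \<subseteq> int_adjoin \<alpha>"
    unfolding int_adjoin_def by blast
qed

lemma L_closed:
  assumes "x \<in> L" "y \<in> L"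
  shows "x + y \<in> L" "x * y \<in> L" "of_rat c * x \<in> L"
  using assms by (auto elim!: L_cases simp: elt_add elt_mult elt_scale)

lemma L_simps [simp]: "0 \<in> L" "1 \<in> L" "\<alpha> \<in> L" "\<alpha> ^ n \<in> L"
proof -
  show "1 \<in> L" "\<alpha> \<in> L" "0 \<in> L" by (metis elt_simps(1-3) elt_in_L)+
  then show "\<alpha> ^ n \<in> L" by (induction n) (auto simp: L_closed)
qed

text \<open>Meaningful on \<open>L\<close> only; every index above 1 reads the coefficient of
  \<alpha>^2. \<open>coord 0\<close> also serves as the \<rat>-linear retraction of \<open>L\<close>
  onto \<rat> in the descent from tensors to \<open>H\<close>.\<close>

definition coord :: "nat \<Rightarrow> 'k \<Rightarrow> rat" where
  "coord i y = (THE c. \<exists>c0 c1 c2. y = elt c0 c1 c2 \<and> c = (if i = 0 then c0 else if i =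
      1 then c1 else c2))"

lemma coord_elt: "coord i (elt c0 c1 c2) = (if i = 0 then c0 else if i = 1 then c1 else c2)"
  unfolding coord_def by (auto simp: elt_inject)

lemma coord_simps [simp]: "coord 0 (elt c0 c1 c2) = c0" "coord (Suc 0) (elt c0 c1 c2) = c1"
  "coord 2 (elt c0 c1 c2) = c2"
  by (simp_all add: coord_elt)

lemma elt_coord: "y \<in> L \<Longrightarrow> elt (coord 0 y) (coord (Suc 0) y) (coord 2 y) = y"
  by (auto elim!: L_cases)

lemma coord_add: "x \<in> L \<Longrightarrow> y \<in> L \<Longrightarrow> coord i (x + y) = coord i x + coord i y"
  by (auto elim!: L_cases simp: elt_add coord_elt)

lemma coord_scale: "x \<in> L \<Longrightarrow> coord i (of_rat c * x) = c * coord i x"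
  by (auto elim!: L_cases simp: elt_scale coord_elt)

lemma coord_0 [simp]: "coord i 0 = 0"
  by (metis coord_elt elt_simps(1))

lemma coord_power: "i < 3 \<Longrightarrow> j < 3 \<Longrightarrow> coord i (\<alpha> ^ j) = (if i = j then 1 else 0)"
  unfolding numeral_3_eq_3 less_Suc_eq
  using coord_elt[of i 1 0 0] coord_elt[of i 0 1 0] coord_elt[of i 0 0 1]
  by (auto simp: elt_simps numeral_2_eq_2[symmetric])

end

section \<open>Matrices of the Hopf algebra over the complex numbers\<close>

lemma sum_lessThan_3: "(\<Sum>l<3::nat. f l) = f 0 + f 1 + (f 2 :: 'c::comm_monoid_add)"
  by (simp add: numeral_3_eq_3 numeral_2_eq_2)

lemma sum_list_zero: "(\<And>t. t \<in> set u \<Longrightarrow> f t = 0) \<Longrightarrow> (\<Sum>t\<leftarrow>u. f t) = (0::'c::monoid_add)"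
  by (induction u) auto

lemma tensors_Nil [simp]: "[] \<in> tensors V W"
  by (simp add: tensors_def)

lemma tensors_Cons [simp]: "t # u \<in> tensors V W \<longleftrightarrow> fst t \<in> carrier V \<and> snd t \<in> carrier W \<and>
    u \<in> tensors V W"
  by (cases t) (auto simp: tensors_def)

lemma galois_map_simps [simp]: "galois_map f [] y = 0" "galois_map f (t # u) y =
    fst t * f (snd t) y + galois_map f u y"
  by (simp_all add: galois_map_def split_def)

lemma tensors_append [simp]: "u @ v \<in> tensors V W \<longleftrightarrow> u \<in> tensors V W \<and> v \<in> tensors V W"
  by (simp add: tensors_def)

lemma galois_map_append [simp]: "galois_map f (u @ v) y = galois_map f u y + galois_map f v y"
  by (simp add: galois_map_def)

lemma galois_map_scale: "galois_map f (map (\<lambda>t. (z * fst t, snd t)) u) y = z * galois_map f u y"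
  by (induction u) (simp_all add: algebra_simps)

lemma sum_list_sum_swap:
  "(\<Sum>x\<leftarrow>xs. \<Sum>l\<in>A. f x l) = (\<Sum>l\<in>A. \<Sum>x\<leftarrow>xs. f x l :: 'a::comm_monoid_add)"
  by (induction xs) (auto simp: sum.distrib)

text \<open>A balanced biadditive map factors through the tensor product. Conditions on the carriers
  suffice, since only generators change entries and those have their entries there.\<close>

lemma tensor_eq_bilinear:
  fixes \<beta> :: "'v \<Rightarrow> 'w \<Rightarrow> 'c::comm_monoid_add"
  assumes "fsum_cong (bilin_rel V W) u v"
    and "\<And>x x' y. x \<in> carrier V \<Longrightarrow> x' \<in> carrier V \<Longrightarrow> y \<in> carrier W \<Longrightarrow>
      \<beta> (x \<oplus>\<^bsub>V\<^esub> x') y = \<beta> x y + \<beta> x' y"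
    and "\<And>x y y'. x \<in> carrier V \<Longrightarrow> y \<in> carrier W \<Longrightarrow> y' \<in> carrier W \<Longrightarrow>
      \<beta> x (y \<oplus>\<^bsub>W\<^esub> y') = \<beta> x y + \<beta> x y'"
    and "\<And>y. y \<in> carrier W \<Longrightarrow> \<beta> \<zero>\<^bsub>V\<^esub> y = 0"
    and "\<And>c x y. x \<in> carrier V \<Longrightarrow> y \<in> carrier W \<Longrightarrow> \<beta> (c \<odot>\<^bsub>V\<^esub> x) y = \<beta> x (c \<odot>\<^bsub>W\<^esub> y)"
  shows "(\<Sum>t\<leftarrow>u. \<beta> (fst t) (snd t)) = (\<Sum>t\<leftarrow>v. \<beta> (fst t) (snd t))"
  using assms(1)
proof induction
  case (gen u v)
  then show ?case by cases (simp_all add: assms(2-5))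
qed (simp_all add: add.commute)

text \<open>A polynomial of degree at most 2 with three distinct zeros vanishes; this turns
  identities at all three roots into identities of coefficients.\<close>

lemma vandermonde_zero:
  fixes r :: "nat \<Rightarrow> 'a::field"
  assumes "inj_on r {..<3}" "\<And>i. i < 3 \<Longrightarrow> c0 + c1 * r i + c2 * r i ^ 2 = 0"
  shows "c0 = 0 \<and> c1 = 0 \<and> c2 = 0"
proof -
  have ne: "r 0 - r 1 \<noteq> 0" "r 0 - r 2 \<noteq> 0" "r 1 - r 2 \<noteq> 0"
    using assms(1) by (simp_all add: inj_on_eq_iff)
  have e: "c0 + c1 * r 0 + c2 * r 0 ^ 2 = 0" "c0 + c1 * r 1 + c2 * r 1 ^ 2 = 0"
    "c0 + c1 * r 2 + c2 * r 2 ^ 2 = 0" by (auto intro: assms(2))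
  then have "(r 0 - r 1) * (c1 + c2 * (r 0 + r 1)) = 0" "(r 0 - r 2) * (c1 + c2 * (r 0 + r 2)) = 0"
    by Groebner_Basis.algebra+
  then have f: "c1 + c2 * (r 0 + r 1) = 0" "c1 + c2 * (r 0 + r 2) = 0" using ne by simp_all
  then have "(r 1 - r 2) * c2 = 0" by Groebner_Basis.algebra
  then show ?thesis using ne e f by simp
qed

text \<open>A monoid structure on three elements whose right translations are surjective
    is the cyclic group.\<close>

lemma three_element_group:
  fixes m :: "nat \<Rightarrow> nat \<Rightarrow> nat"
  assumes "\<And>s p. s < 3 \<Longrightarrow> p < 3 \<Longrightarrow> m s p < 3"
    and "\<And>p. p < 3 \<Longrightarrow> m 0 p = p" and "\<And>s. s < 3 \<Longrightarrow> m s 0 = s"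
    and "\<And>s t p. s < 3 \<Longrightarrow> t < 3 \<Longrightarrow> p < 3 \<Longrightarrow> m s (m t p) = m (m s t) p"
    and "\<And>p k. p < 3 \<Longrightarrow> k < 3 \<Longrightarrow> \<exists>s<3. m s p = k"
  shows "m 1 1 = 2 \<and> m 1 2 = 0 \<and> m 2 1 = 0 \<and> m 2 2 = 1"
proof -
  have z: "m 0 1 = 1" "m 0 2 = 2" "m 1 0 = 1" "m 2 0 = 2" "m 0 0 = 0" using assms(2,3) by simp_all
  have lt: "s < 3 \<Longrightarrow> s = 0 \<or> s = 1 \<or> s = 2" for s :: nat by linarith
  have one: "k = m 0 p \<or> k = m 1 p \<or> k = m 2 p" if "p < 3" "k < 3" for p k
    using assms(5)[OF that] lt by metis
  \<comment> \<open>The column of p = 1 contains each of 0, 1, 2 and starts with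
    \<open>m 0 1 = 1\<close>, so two fillings remain; likewise for p = 2. Associativity rejects all
    combinations but the cyclic one.\<close>
  have "m 1 1 = 0 \<and> m 2 1 = 2 \<or> m 1 1 = 2 \<and> m 2 1 = 0"
    using one[of 1 0] one[of 1 2] z by simp linarith
  moreover have "m 1 2 = 0 \<and> m 2 2 = 1 \<or> m 1 2 = 1 \<and> m 2 2 = 0"
    using one[of 2 0] one[of 2 1] z by simp linarith
  moreover have "m 1 (m 1 1) = m (m 1 1) 1" "m 1 (m 2 1) = m (m 1 2) 1" "m 1 (m 1 2) = m (m 1 1) 2"
     "m 1 (m 2 2) = m (m 1 2) 2" "m 2 (m 1 1) = m (m 2 1) 1"
    using assms(4) by simp_all
  ultimately show ?thesis using z by (elim disjE conjE) simp_all
qed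

section \<open>The complex embeddings of the cubic field\<close>

context cubic_number_field
begin

lemma complex_roots_exist:
  "\<exists>r :: nat \<Rightarrow> complex. inj_on r {..<3} \<and> (\<forall>i<3. r i ^ 3 = of_int a * r i - of_int b)"
proof -
  define A B where "A = (of_int a :: complex)" and "B = (of_int b :: complex)"
  have "\<not> constant (poly [:B, - A, 0, 1:])" by (subst constant_degree) simp
  then obtain z where "poly [:B, - A, 0, 1:] z = 0" using fundamental_theorem_of_algebra by blast
  then have z: "z ^ 3 = A * z - B" by (simp add: power3_eq_cube algebra_simps add_eq_0_iff)
  \<comment> \<open>Dividing f by X - z leaves X^2 + z X + z^2 - A, whose discriminant is 4 A - 3
    z^2.\<close>
  define s where "s = csqrt (4 * A - 3 * z ^ 2)"
  have s: "s ^ 2 = 4 * A - 3 * z ^ 2" by (simp add: s_def)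
  define r where "r = (\<lambda>i::nat. if i = 0 then z else if i = 1 then (- z +
      s) / 2 else (- z - s) / 2)"
  have "((- z + s) / 2) ^ 3 = A * ((- z + s) / 2) - B"
  proof -
    have "(- z + s) ^ 3 = 4 * (A * (- z + s)) - 8 * B" using z s by Groebner_Basis.algebra
    then show ?thesis by (simp add: power_divide divide_simps)
  qed
  moreover have "((- z - s) / 2) ^ 3 = A * ((- z - s) / 2) - B"
  proof -
    have "(- z - s) ^ 3 = 4 * (A * (- z - s)) - 8 * B" using z s by Groebner_Basis.algebra
    then show ?thesis by (simp add: power_divide divide_simps)
  qed
  ultimately have rt: "\<forall>i<3. r i ^ 3 = A * r i - B" using z by (auto simp: r_def)
  have "of_int disc \<noteq> (0::complex)" using disc_nonzero by simp
  then have d: "4 * A ^ 3 - 27 * B ^ 2 \<noteq> 0" by (simp add: disc_def A_def B_def)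
  \<comment> \<open>Here s is the difference of the other two roots, and s^2 - 9 z^2 is -4 times the
    product of their differences from z. A nonzero discriminant therefore separates all
    three.\<close>
  have "(s * (s ^ 2 - 9 * z ^ 2)) ^ 2 = 16 * (4 * A ^ 3 - 27 * B ^ 2)"
    using z s by Groebner_Basis.algebra
  then have "s \<noteq> 0" "s ^ 2 \<noteq> (3 * z) ^ 2" using d by (auto simp: power_mult_distrib)
  then have "s \<noteq> 0" "s \<noteq> 3 * z" "- s \<noteq> 3 * z" by (auto dest: arg_cong[of _ _ "\<lambda>x. x ^ 2"])
  then have "z \<noteq> (- z + s) / 2" "z \<noteq> (- z - s) / 2" "(- z + s) / 2 \<noteq> (- z - s) / 2"
    by (auto simp: field_simps add_eq_0_iff2)
  moreover have "i = 0 \<or> i = 1 \<or> i = 2" if "i < 3" for i :: nat using that by auto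
  ultimately have "inj_on r {..<3}"
    unfolding inj_on_def r_def by (metis lessThan_iff)
  then show ?thesis using rt unfolding A_def B_def by blast
qed

text \<open>As \<open>'k\<close> comes with no map to \<complex>, the embedding sending \<alpha> to
  z is written through coordinates. It is \<rat>-linear on \<open>L\<close> for every z;
  multiplicativity needs z to be a root.\<close>

definition emb :: "complex \<Rightarrow> 'k \<Rightarrow> complex" where
  "emb z y = of_rat (coord 0 y) + of_rat (coord 1 y) * z + of_rat (coord 2 y) * z ^ 2"

lemma emb_elt: "emb z (elt c0 c1 c2) = of_rat c0 + of_rat c1 * z + of_rat c2 * z ^ 2"
  by (simp add: emb_def)

lemma emb_add: "x \<in> L \<Longrightarrow> y \<in> L \<Longrightarrow> emb z (x + y) = emb z x + emb z y"
  by (auto elim!: L_cases simp: elt_add emb_elt of_rat_add algebra_simps)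

lemma emb_scale: "x \<in> L \<Longrightarrow> emb z (of_rat c * x) = of_rat c * emb z x"
  by (auto elim!: L_cases simp: elt_scale emb_elt of_rat_mult algebra_simps)

lemma emb_mult:
  assumes "z ^ 3 = of_int a * z - of_int b" "x \<in> L" "y \<in> L"
  shows "emb z (x * y) = emb z x * emb z y"
proof -
  obtain c0 c1 c2 d0 d1 d2 where "x = elt c0 c1 c2" "y = elt d0 d1 d2"
    using assms(2,3) by (metis L_cases)
  then show ?thesis
    unfolding elt_mult emb_elt of_rat_add of_rat_diff of_rat_mult of_rat_of_int_eq
    by (simp only: elt_mult emb_elt of_rat_add of_rat_diff of_rat_mult of_rat_of_int_eq
        cubic_relation_mult[OF assms(1)])
qed

lemma emb_simps [simp]: "emb z 0 = 0" "emb z 1 = 1" "emb z \<alpha> = z"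
  using emb_elt[of z 0 0 0] emb_elt[of z 1 0 0] emb_elt[of z 0 1 0] by (simp_all add: elt_simps)

lemma emb_of_rat [simp]: "emb z (of_rat c) = of_rat c"
  using emb_elt[of z c 0 0] by (simp add: elt_simps)

lemma emb_power: "z ^ 3 = of_int a * z - of_int b \<Longrightarrow> emb z (\<alpha> ^ n) = z ^ n"
  by (induction n) (simp_all add: emb_mult)

lemma L_sum: "(\<And>i. i \<in> A \<Longrightarrow> f i \<in> L) \<Longrightarrow> sum f A \<in> L"
  by (induction A rule: infinite_finite_induct) (auto intro: L_closed)

lemma emb_sum: "(\<And>i. i \<in> A \<Longrightarrow> f i \<in> L) \<Longrightarrow> emb z (sum f A) = (\<Sum>i\<in>A. emb z (f i))"
  by (induction A rule: infinite_finite_induct) (auto simp: emb_add L_sum)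

lemma sum_coord: "y \<in> L \<Longrightarrow> (\<Sum>l<3. of_rat (coord l y) * \<alpha> ^ l) = y"
  using elt_coord[of y] by (simp add: elt_def numeral_3_eq_3 numeral_2_eq_2 add.assoc)

end

section \<open>The action on powers of \<alpha> and the coordinate functionals as tensors\<close>

locale cubic_hopf_galois = cubic_number_field a b \<alpha> + hopf_galois_structure "rat_adjoin \<alpha>" H act
  for a b :: int and \<alpha> :: "'k::field_char_0" and H :: "('h, 'm) hopf_scheme" (structure)
    and act :: "'h \<Rightarrow> 'k \<Rightarrow> 'k"
begin

lemma act_additive: "h \<in> carrier H \<Longrightarrow> x \<in> L \<Longrightarrow> y \<in> L \<Longrightarrow> act h (x + y) = act h x + act h y"
  and act_scale: "h \<in> carrier H \<Longrightarrow> x \<in> L \<Longrightarrow> act h (of_rat c * x) = of_rat c * act h x"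
  using act_endo[of h] by (auto simp: rat_endos_def)

lemma act_0: "h \<in> carrier H \<Longrightarrow> act h 0 = 0"
  using act_scale[of h 0 0] by simp

lemma act_sum: "h \<in> carrier H \<Longrightarrow> (\<And>i. i \<in> A \<Longrightarrow> f i \<in> L) \<Longrightarrow> act h (sum f A) = (\<Sum>i\<in>A. act h (f i))"
  by (induction A rule: infinite_finite_induct) (auto simp: act_additive L_sum act_0)

lemma act_expand:
  assumes "h \<in> carrier H" "y \<in> L"
  shows "act h y = (\<Sum>l<3. of_rat (coord l y) * act h (\<alpha> ^ l))"
proof -
  have "act h y = act h (\<Sum>l<3. of_rat (coord l y) * \<alpha> ^ l)" using assms sum_coord by simp
  also have "\<dots> = (\<Sum>l<3. act h (of_rat (coord l y) * \<alpha> ^ l))"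
    by (rule act_sum) (use assms in \<open>auto intro: L_closed\<close>)
  also have "\<dots> = (\<Sum>l<3. of_rat (coord l y) * act h (\<alpha> ^ l))"
    using assms by (simp add: act_scale)
  finally show ?thesis .
qed

lemma smult_in_H [simp]: "h \<in> carrier H \<Longrightarrow> c \<odot> h \<in> carrier H"
  by (rule V.smult_closed) (auto simp: rat_ring_def)

lemma carrier_field_alg [simp]: "carrier (field_alg L) = L"
  by (simp add: field_alg_def)

lemma galois_map_L: "u \<in> tensors (field_alg L) H \<Longrightarrow> y \<in> L \<Longrightarrow> galois_map act u y \<in> L"
  by (induction u) (auto intro!: L_closed act_closed)

lemma emb_galois_map:
  assumes "z ^ 3 = of_int a * z - of_int b" "u \<in> tensors (field_alg L) H" "y \<in> L"
  shows "emb z (galois_map act u y) = (\<Sum>t\<leftarrow>u. emb z (fst t) * emb z (act (snd t) y))"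
  using assms(2) by (induction u) (auto simp: emb_add emb_mult assms L_closed act_closed
      galois_map_L)

text \<open>A chosen preimage of the j-th coordinate functional, viewed as an endomorphism of
  \<open>L\<close>. An endomorphism is the sum of its values at \<alpha>^j times these functionals,
  so they generate L \<otimes> H over L.\<close>

definition coord_tensor :: "nat \<Rightarrow> ('k \<times> 'h) list" where
  "coord_tensor j = (SOME u. u \<in> tensors (field_alg L) H \<and> (\<forall>y\<in>L. galois_map act u y =
      of_rat (coord j y)))"

lemma coord_tensor:
  "coord_tensor j \<in> tensors (field_alg L) H"
  "y \<in> L \<Longrightarrow> galois_map act (coord_tensor j) y = of_rat (coord j y)"
proof -
  have "of_rat c \<in> L" for c by (metis elt_simps(5) elt_in_L)
  then have "(\<lambda>y. of_rat (coord j y)) \<in> rat_endos L"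
    by (auto simp: rat_endos_def coord_add coord_scale of_rat_add of_rat_mult)
  from galois_surj[OF this]
  have "\<exists>u. u \<in> tensors (field_alg L) H \<and> (\<forall>y\<in>L. galois_map act u y = of_rat (coord j y))" by blast
  from someI_ex[OF this] show "coord_tensor j \<in> tensors (field_alg L) H"
    "y \<in> L \<Longrightarrow> galois_map act (coord_tensor j) y = of_rat (coord j y)"
    unfolding coord_tensor_def by blast+
qed

end

section \<open>Matrices of the action with respect to the three embeddings\<close>

locale cubic_hopf_galois_roots = cubic_hopf_galois a b \<alpha> H act
  for a b :: int and \<alpha> :: "'k::field_char_0" and H :: "('h, 'm) hopf_scheme" (structure)
    and act :: "'h \<Rightarrow> 'k \<Rightarrow> 'k" +
  fixes r :: "nat \<Rightarrow> complex"
  assumes r_inj: "inj_on r {..<3}" and r_cube: "i < 3 \<Longrightarrow> r i ^ 3 = of_int a * r i - of_int b"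
begin

lemma r_eq_iff: "i < 3 \<Longrightarrow> j < 3 \<Longrightarrow> r i = r j \<longleftrightarrow> i = j"
  using r_inj by (simp add: inj_on_eq_iff)

lemma r_quadratic:
  assumes "i < 3" "j < 3" "i \<noteq> j"
  shows "r i ^ 2 + r i * r j + r j ^ 2 = of_int a"
proof -
  have "(r i - r j) * (r i ^ 2 + r i * r j + r j ^ 2) = r i ^ 3 - r j ^ 3"
    by (simp add: algebra_simps power2_eq_square power3_eq_cube)
  also have "\<dots> = (r i - r j) * of_int a"
    unfolding r_cube[OF assms(1)] r_cube[OF assms(2)] by (simp add: algebra_simps)
  finally show ?thesis using assms by (simp add: r_eq_iff)
qed

lemma r_sum: "r 0 + r 1 + r 2 = 0"
proof -
  have "r 0 ^ 2 + r 0 * r 2 + r 2 ^ 2 = r 1 ^ 2 + r 1 * r 2 + r 2 ^ 2"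
    by (simp add: r_quadratic)
  then have "(r 0 - r 1) * (r 0 + r 1 + r 2) = 0"
    by Groebner_Basis.algebra
  then show ?thesis by (simp add: r_eq_iff)
qed

text \<open>This is f'(r i), the product of the differences of r i from the other two roots; it is
  the denominator in \<open>lagr\<close>.\<close>

lemma r_deriv_nonzero:
  assumes "i < 3"
  shows "3 * r i ^ 2 - of_int a \<noteq> 0"
proof -
  have A: "of_int a = r 0 ^ 2 + r 0 * r 1 + r 1 ^ 2" by (simp add: r_quadratic)
  have "r 0 - r 1 \<noteq> 0" "r 0 - r 2 \<noteq> 0" "r 1 - r 2 \<noteq> 0" by (simp_all add: r_eq_iff)
  moreover have "i = 0 \<or> i = 1 \<or> i = 2" using assms by auto
  moreover have "3 * r 0 ^ 2 - of_int a = (r 0 - r 1) * (r 0 - r 2)"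
    "3 * r 1 ^ 2 - of_int a = (r 0 - r 1) * (r 2 - r 1)"
    "3 * r 2 ^ 2 - of_int a = (r 0 - r 2) * (r 1 - r 2)"
    unfolding A using r_sum by Groebner_Basis.algebra+
  ultimately show ?thesis by auto
qed

text \<open>The coefficients of the Lagrange basis polynomials at the roots, that is the inverse
  Vandermonde matrix.\<close>

definition lagr :: "nat \<Rightarrow> nat \<Rightarrow> complex" where
  "lagr k l = (if l = 0 then r k ^ 2 - of_int a else if l =
      1 then r k else 1) / (3 * r k ^ 2 - of_int a)"

lemma lagr_eval:
  assumes "k < 3" "j < 3"
  shows "(\<Sum>l<3. lagr k l * r j ^ l) = (if j = k then 1 else 0)"
proof -
  \<comment> \<open>The k-th Lagrange polynomial is f(X) / ((X - r k) f'(r k)), and f(X) / (X - r k)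
    = X^2 + r k X + r k^2 - a.\<close>
  have "(\<Sum>l<3. lagr k l * r j ^ l) = (r k ^ 2 + r k * r j +
      r j ^ 2 - of_int a) / (3 * r k ^ 2 - of_int a)"
    by (simp add: sum_lessThan_3 lagr_def add_divide_distrib diff_divide_distrib)
  then show ?thesis
    using r_quadratic[OF assms] r_deriv_nonzero[OF assms(1)]
    by (auto simp: power2_eq_square)
qed

text \<open>The inverse relation on the other side: the defects X l are the coefficients of a
  polynomial that vanishes at all three roots by \<open>lagr_eval\<close>.\<close>

lemma lagr_coeff:
  assumes "l < 3" "m < 3"
  shows "(\<Sum>k<3. lagr k l * r k ^ m) = (if l = m then 1 else 0)"
proof -
  define X where "X l = (\<Sum>k<3. lagr k l * r k ^ m) - (if l = m then 1 else 0)" for l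
  have "X 0 + X 1 * r j + X 2 * r j ^ 2 = 0" if "j < 3" for j
  proof -
    have "X 0 + X 1 * r j + X 2 * r j ^ 2 = (\<Sum>l<3. X l * r j ^ l)"
      by (simp add: sum_lessThan_3)
    also have "\<dots> = (\<Sum>l<3. \<Sum>k<3. lagr k l * r k ^ m * r j ^ l) - (\<Sum>l<3. (if l =
        m then r j ^ l else 0))"
      unfolding sum_subtractf[symmetric]
      by (rule sum.cong) (auto simp: X_def left_diff_distrib sum_distrib_right)
    also have "(\<Sum>l<3. \<Sum>k<3. lagr k l * r k ^ m * r j ^ l) = (\<Sum>k<3. r k ^ m * (\<Sum>l<3.
        lagr k l * r j ^ l))"
      by (subst sum.swap) (simp add: sum_distrib_left ac_simps)
    also have "\<dots> = (\<Sum>k<3. if k = j then r k ^ m else 0)"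
      by (rule sum.cong) (auto simp: lagr_eval that)
    finally show ?thesis using that assms by simp
  qed
  then have "X 0 = 0 \<and> X 1 = 0 \<and> X 2 = 0" by (rule vandermonde_zero[OF r_inj])
  moreover have "l = 0 \<or> l = 1 \<or> l = 2" using assms by auto
  ultimately have "X l = 0" by auto
  then show ?thesis by (simp add: X_def)
qed

text \<open>The matrix of \<open>h\<close> on \<open>\<complex> \<otimes> L\<close> in the basis of idempotents.\<close>

definition mat :: "'h \<Rightarrow> nat \<Rightarrow> nat \<Rightarrow> complex" where
  "mat h i k = (\<Sum>l<3. lagr k l * emb (r i) (act h (\<alpha> ^ l)))"

lemma emb_coord: "j < 3 \<Longrightarrow> y \<in> L \<Longrightarrow> emb (r j) y = (\<Sum>l<3. of_rat (coord l y) * r j ^ l)"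
  by (simp add: emb_def sum_lessThan_3)

lemma emb_act:
  assumes "h \<in> carrier H" "i < 3" "y \<in> L"
  shows "emb (r i) (act h y) = (\<Sum>k<3. mat h i k * emb (r k) y)"
proof -
  have "(\<Sum>k<3. mat h i k * emb (r k) y) =
      (\<Sum>k<3. \<Sum>l<3. \<Sum>m<3. lagr k l * emb (r i) (act h (\<alpha> ^ l)) * (of_rat (coord m y) * r k ^ m))"
    by (rule sum.cong) (simp_all add: mat_def emb_coord assms sum_product)
  also have "\<dots> = (\<Sum>l<3. \<Sum>k<3. \<Sum>m<3.
      lagr k l * emb (r i) (act h (\<alpha> ^ l)) * (of_rat (coord m y) * r k ^ m))"
    by (rule sum.swap)
  also have "\<dots> = (\<Sum>l<3. \<Sum>m<3. \<Sum>k<3.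
      lagr k l * emb (r i) (act h (\<alpha> ^ l)) * (of_rat (coord m y) * r k ^ m))"
    by (rule sum.cong[OF HOL.refl]) (rule sum.swap)
  also have "\<dots> = (\<Sum>l<3. \<Sum>m<3. emb (r i) (act h (\<alpha> ^ l)) * of_rat (coord m y) * (\<Sum>k<3.
      lagr k l * r k ^ m))"
    by (simp add: sum_distrib_left ac_simps)
  also have "\<dots> = (\<Sum>l<3. \<Sum>m<3. if l = m then emb (r i) (act h (\<alpha> ^ l)) * of_rat (coord m y) else 0)"
    by (intro sum.cong HOL.refl) (simp add: lagr_coeff)
  also have "\<dots> = (\<Sum>l<3. emb (r i) (of_rat (coord l y) * act h (\<alpha> ^ l)))"
    using assms by (simp add: emb_scale act_closed ac_simps)
  also have "\<dots> = emb (r i) (act h y)"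
    unfolding act_expand[OF assms(1,3)] using assms
    by (subst emb_sum) (auto intro!: L_closed act_closed)
  finally show ?thesis by simp
qed

lemma mat_add: "h \<in> carrier H \<Longrightarrow> h' \<in> carrier H \<Longrightarrow> mat (h \<oplus> h') i k = mat h i k + mat h' i k"
  by (simp add: mat_def act_add_left emb_add act_closed distrib_left sum.distrib)

lemma mat_smult: "h \<in> carrier H \<Longrightarrow> mat (c \<odot> h) i k = of_rat c * mat h i k"
  by (simp add: mat_def act_smult_left emb_scale act_closed sum_distrib_left ac_simps)

lemma mat_mult:
  assumes "h \<in> carrier H" "h' \<in> carrier H" "i < 3"
  shows "mat (h \<otimes> h') i k = (\<Sum>j<3. mat h i j * mat h' j k)"
proof -
  have "mat (h \<otimes> h') i k = (\<Sum>l<3. \<Sum>j<3. lagr k l * (mat h i j * emb (r j) (act h' (\<alpha> ^ l))))"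
    using assms by (simp add: mat_def act_mult emb_act act_closed sum_distrib_left)
  also have "\<dots> = (\<Sum>j<3. mat h i j * mat h' j k)"
    by (subst sum.swap) (simp add: mat_def sum_distrib_left ac_simps)
  finally show ?thesis .
qed

lemma mat_one: "i < 3 \<Longrightarrow> k < 3 \<Longrightarrow> mat \<one> i k = (if i = k then 1 else 0)"
  by (simp add: mat_def act_one emb_power r_cube lagr_eval)

text \<open>The matrix of \<open>coord_tensor j\<close> once the p-th embedding has carried its
  coefficients to \<complex>, that is, as an element of \<complex> \<otimes> H.\<close>

definition coord_mat :: "nat \<Rightarrow> nat \<Rightarrow> nat \<Rightarrow> nat \<Rightarrow> complex" where
  "coord_mat p j i k = (\<Sum>t\<leftarrow>coord_tensor j. emb (r p) (fst t) * mat (snd t) i k)"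

text \<open>The embedding of the coefficients must agree with the row: only then do the two factors
  combine to the p-th embedding of the Galois map, which is known.\<close>

lemma coord_mat_diag:
  assumes "p < 3" "j < 3"
  shows "coord_mat p j p k = lagr k j"
proof -
  have "coord_mat p j p k = (\<Sum>t\<leftarrow>coord_tensor j. \<Sum>l<3.
      lagr k l * (emb (r p) (fst t) * emb (r p) (act (snd t) (\<alpha> ^ l))))"
    unfolding coord_mat_def mat_def sum_distrib_left by (simp add: ac_simps)
  also have "\<dots> = (\<Sum>l<3. lagr k l * emb (r p) (galois_map act (coord_tensor j) (\<alpha> ^ l)))"
    unfolding sum_list_sum_swap
    by (simp add: sum_list_const_mult emb_galois_map[OF r_cube[OF assms(1)] coord_tensor(1)])
  also have "\<dots> = (\<Sum>l<3. if l = j then lagr k l else 0)"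
    using assms by (intro sum.cong HOL.refl) (auto simp: coord_tensor coord_power)
  finally show ?thesis using assms by simp
qed

text \<open>Surjectivity of the Galois map in usable form. The p-th rows of the coordinate
  functionals form the invertible matrix \<open>lagr\<close>, so a linear form killing row p of all
  of \<open>H\<close> is zero.\<close>

lemma mat_rows_span:
  assumes "p < 3" "\<And>h. h \<in> carrier H \<Longrightarrow> (\<Sum>s<3. mat h p s * c s) = 0" "k < 3"
  shows "c k = 0"
proof -
  have "(\<Sum>s<3. lagr s j * c s) = 0" if "j < 3" for j
  proof -
    have "(\<Sum>s<3. lagr s j * c s) = (\<Sum>s<3. coord_mat p j p s * c s)"
      using that assms by (simp add: coord_mat_diag)
    also have "\<dots> = (\<Sum>t\<leftarrow>coord_tensor j. emb (r p) (fst t) * (\<Sum>s<3. mat (snd t) p s * c s))"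
      unfolding coord_mat_def sum_distrib_left sum_list_sum_swap
      by (simp add: ac_simps sum_list_const_mult)
    also have "\<dots> = 0"
      using coord_tensor(1)[of j] assms(2)
      by (intro sum_list_zero) (auto simp: tensors_def)
    finally show ?thesis .
  qed
  then have "(\<Sum>j<3. (\<Sum>s<3. lagr s j * c s) * r k ^ j) = 0" by simp
  also have "(\<Sum>j<3. (\<Sum>s<3. lagr s j * c s) * r k ^ j) = (\<Sum>s<3. c s * (\<Sum>j<3. lagr s j * r k ^ j))"
    unfolding sum_distrib_left sum_distrib_right by (subst sum.swap) (simp add: ac_simps)
  also have "\<dots> = (\<Sum>s<3. if s = k then c s else 0)"
    using assms by (intro sum.cong HOL.refl) (auto simp: lagr_eval)
  finally show ?thesis using assms by simp
qed

end

section \<open>Group-like elements and circulant matrices\<close>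

text \<open>The circulant operator with entries m0, m1, m2 is X + Y d (\<sigma> -
  \<open>\<sigma>\<^sup>2\<close>) plus a multiple of the trace. The factor 3 clears the
  denominators of the entries in terms of e, X, Y.\<close>

lemma circulant_on_roots:
  fixes u v e X Y :: "'a::field_char_0"
  assumes "w = - u - v" "d = - ((u - v) * (v - w) * (w - u))"
    and "A = u ^ 2 + u * v + v ^ 2" "B = u * v * (u + v)"
    and "3 * m0 = e + 2 * X" "3 * m1 = e - X + 3 * d * Y" "3 * m2 = e - X - 3 * d * Y"
  shows "m0 * u + m1 * v + m2 * w = - 4 * A ^ 2 * Y + (X + 9 * B * Y) * u +
      6 * A * Y * u ^ 2" (is ?a)
    and "3 * (m0 * u ^ 2 + m1 * v ^ 2 + m2 * w ^ 2) =
      2 * A * (e - X + 9 * B * Y) - 6 * A ^ 2 * Y * u + 3 * (X - 9 * B * Y) * u ^ 2" (is ?b)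
proof -
  have "3 * (m0 * u + m1 * v + m2 * w) = 3 * (- 4 * A ^ 2 * Y + (X + 9 * B * Y) * u +
      6 * A * Y * u ^ 2)"
    unfolding distrib_left[of 3] mult.assoc[of 3, symmetric] assms(5-7) unfolding assms(1-4)
      by Groebner_Basis.algebra
  then show ?a by (rule mult_left_cancel[THEN iffD1, rotated]) simp
  show ?b
    unfolding distrib_left[of 3] mult.assoc[of 3, symmetric] assms(5-7) unfolding assms(1-4)
      by Groebner_Basis.algebra
qed

context cubic_hopf_galois_roots
begin

text \<open>The matrix of the element of \<open>\<complex> \<otimes> H\<close> that restricts to the \<open>s\<close>-th embedding of \<open>L\<close> in row \<open>0\<close>;
  it will turn out to be a permutation matrix.\<close>

definition grouplike :: "nat \<Rightarrow> nat \<Rightarrow> nat \<Rightarrow> complex" where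
  "grouplike s i k = (\<Sum>j<3. r s ^ j * coord_mat 0 j i k)"

lemma tensors_scale: "z \<in> L \<Longrightarrow> u \<in> tensors (field_alg L) H \<Longrightarrow>
    map (\<lambda>t. (z * fst t, snd t)) u \<in> tensors (field_alg L) H"
  by (induction u) (auto intro: L_closed)

text \<open>Expanding \<open>h\<close> along the coordinate functionals and using injectivity of the Galois map, the
  whole matrix of \<open>h\<close> is a linear function of its row \<open>0\<close>.\<close>

lemma mat_determined_by_row:
  assumes h: "h \<in> carrier H"
  shows "mat h i k = (\<Sum>s<3. mat h 0 s * grouplike s i k)"
proof -
  define w where "w j = map (\<lambda>t. (act h (\<alpha> ^ j) * fst t, snd t)) (coord_tensor j)" for j
  define v where "v = w 0 @ w 1 @ w 2"
  have w: "w j \<in> tensors (field_alg L) H" for j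
    unfolding w_def by (intro tensors_scale act_closed h L_simps coord_tensor)
  have v: "v \<in> tensors (field_alg L) H" by (simp add: v_def w)
  have "galois_map act (w j) y = of_rat (coord j y) * act h (\<alpha> ^ j)" if "y \<in> L" for j y
    unfolding w_def galois_map_scale coord_tensor(2)[OF that] by (rule mult.commute)
  then have "galois_map act v y = galois_map act [(1, h)] y" if "y \<in> L" for y
    using act_expand[OF h that] that by (simp add: v_def sum_lessThan_3 add.assoc)
  then have "tensor_eq (field_alg L) H v [(1, h)]"
    using v h by (intro galois_inj) auto
  then have "(\<Sum>t\<leftarrow>v. emb (r 0) (fst t) * mat (snd t) i k) =
      (\<Sum>t\<leftarrow>[(1, h)]. emb (r 0) (fst t) * mat (snd t) i k)"
    by (rule tensor_eq_bilinear)
      (auto simp: field_alg_def emb_add emb_scale mat_add mat_smult ring_distribs mult.assoc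
          mult.left_commute)
  moreover have "(\<Sum>t\<leftarrow>w j. emb (r 0) (fst t) * mat (snd t) i k) =
      emb (r 0) (act h (\<alpha> ^ j)) * coord_mat 0 j i k" for j
  proof -
    have "(\<Sum>t\<leftarrow>w j. emb (r 0) (fst t) * mat (snd t) i k) =
        (\<Sum>t\<leftarrow>coord_tensor j. emb (r 0) (act h (\<alpha> ^ j)) * (emb (r 0) (fst t) * mat (snd t) i k))"
      unfolding w_def map_map comp_def using coord_tensor(1)[of j]
      by (intro arg_cong[of _ _ sum_list] map_cong HOL.refl)
        (auto simp: emb_mult r_cube act_closed h tensors_def)
    then show ?thesis by (simp add: coord_mat_def sum_list_const_mult)
  qed
  ultimately have "mat h i k = (\<Sum>j<3. emb (r 0) (act h (\<alpha> ^ j)) * coord_mat 0 j i k)"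
    by (simp add: v_def sum_lessThan_3 add.assoc)
  also have "\<dots> = (\<Sum>j<3. \<Sum>s<3. mat h 0 s * r s ^ j * coord_mat 0 j i k)"
    by (simp add: emb_act h emb_power r_cube sum_distrib_right)
  also have "\<dots> = (\<Sum>s<3. mat h 0 s * grouplike s i k)"
    by (subst sum.swap) (simp add: grouplike_def sum_distrib_left ac_simps)
  finally show ?thesis .
qed

lemma grouplike_row_0: "s < 3 \<Longrightarrow> k < 3 \<Longrightarrow> grouplike s 0 k = (if s = k then 1 else 0)"
  using lagr_eval[of k s] by (auto simp: grouplike_def coord_mat_diag ac_simps)

lemma grouplike_0: "i < 3 \<Longrightarrow> k < 3 \<Longrightarrow> grouplike 0 i k = (if i = k then 1 else 0)"
  using mat_determined_by_row[of \<one> i k] by (simp add: mat_one sum_lessThan_3)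

text \<open>The transfer principle: an identity indexed by the embeddings may be checked after
  pairing with row 0 of every h, where the axioms of \<open>H\<close> are available.\<close>

lemma row_0_eqI:
  assumes "\<And>h. h \<in> carrier H \<Longrightarrow> (\<Sum>s<3. mat h 0 s * c s) = (\<Sum>s<3. mat h 0 s * d s)" "k < 3"
  shows "c k = d k"
  using mat_rows_span[of 0 "\<lambda>s. c s - d s" k] assms by (simp add: right_diff_distrib sum_subtractf)

text \<open>The module-algebra axiom evaluated on two of the orthogonal idempotents of \<complex>
  \<otimes> L.\<close>

lemma mat_comult:
  assumes h: "h \<in> carrier H" and "i < 3" "k < 3" "k' < 3"
  shows "(\<Sum>t\<leftarrow>comult H h. mat (fst t) i k * mat (snd t) i k') = (if k = k' then mat h i k else 0)"
proof -
  let ?E = "\<lambda>h l. emb (r i) (act h (\<alpha> ^ l))"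
  have cm: "comult H h \<in> tensors H H" by (rule comult_closed[OF h])
  have act_mult': "emb (r i) (act h (y * z)) = (\<Sum>t\<leftarrow>comult H h.
      emb (r i) (act (fst t) y) * emb (r i) (act (snd t) z))"
    if "y \<in> L" "z \<in> L" for y z
  proof -
    have "act h (y * z) = (\<Sum>t\<leftarrow>comult H h. act (fst t) y * act (snd t) z)"
      unfolding act_alg_mult[OF h that] by (simp add: split_def)
    moreover have "(\<Sum>t\<leftarrow>u. act (fst t) y * act (snd t) z) \<in> L \<and>
        emb (r i) (\<Sum>t\<leftarrow>u. act (fst t) y * act (snd t) z) =
        (\<Sum>t\<leftarrow>u. emb (r i) (act (fst t) y) * emb (r i) (act (snd t) z))" if "u \<in> tensors H H" for u
      using that \<open>y \<in> L\<close> \<open>z \<in> L\<close> assms(2)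
      by (induction u) (auto simp: emb_add emb_mult r_cube act_closed L_closed)
    ultimately show ?thesis using cm by simp
  qed
  have "(\<Sum>t\<leftarrow>comult H h. mat (fst t) i k * mat (snd t) i k') =
      (\<Sum>l<3. \<Sum>m<3. lagr k l * lagr k' m * (\<Sum>t\<leftarrow>comult H h. ?E (fst t) l * ?E (snd t) m))"
    unfolding mat_def sum_product sum_list_sum_swap by (simp add: sum_list_const_mult ac_simps)
  also have "\<dots> = (\<Sum>l<3. \<Sum>m<3. lagr k l * lagr k' m * (\<Sum>s<3. mat h i s * (r s ^ l * r s ^ m)))"
    by (simp add: emb_act h assms emb_mult emb_power r_cube L_closed(2) flip: act_mult')
  also have "\<dots> = (\<Sum>s<3. mat h i s * ((\<Sum>l<3. lagr k l * r s ^ l) * (\<Sum>m<3. lagr k' m * r s ^ m)))"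
    by (simp add: sum_lessThan_3 algebra_simps)
  also have "\<dots> = (\<Sum>s<3. if s = k \<and> k = k' then mat h i s else 0)"
    by (intro sum.cong HOL.refl) (auto simp: lagr_eval assms)
  also have "\<dots> = (if k = k' then mat h i k else 0)"
    using assms by (cases "k = k'") auto
  finally show ?thesis .
qed

text \<open>On row 0, \<open>mat_comult\<close> says that the comultiplication sends the s-th
  element to its own tensor square; read in row i it makes the entries orthogonal
  idempotents.\<close>

lemma grouplike_idem:
  assumes "s < 3" "i < 3" "k < 3" "k' < 3"
  shows "grouplike s i k * grouplike s i k' = (if k = k' then grouplike s i k else 0)"
proof (rule row_0_eqI[OF _ assms(1), where d = "\<lambda>s. if k = k' then grouplike s i k else 0"])
  fix h assume h: "h \<in> carrier H"
  have cm: "comult H h \<in> tensors H H" by (rule comult_closed[OF h])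
  have "(\<Sum>s<3. mat h 0 s * (if k = k' then grouplike s i k else 0)) = (if k =
      k' then mat h i k else 0)"
    using mat_determined_by_row[OF h, of i k] by (cases "k = k'") simp_all
  also have "\<dots> = (\<Sum>t\<leftarrow>comult H h. mat (fst t) i k * mat (snd t) i k')"
    by (simp add: mat_comult h assms)
  also have "\<dots> = (\<Sum>t\<leftarrow>comult H h. \<Sum>s<3. \<Sum>s'<3.
      grouplike s i k * grouplike s' i k' * (mat (fst t) 0 s * mat (snd t) 0 s'))"
  proof (intro arg_cong[of _ _ sum_list] map_cong HOL.refl)
    fix t assume "t \<in> set (comult H h)"
    then have "fst t \<in> carrier H" "snd t \<in> carrier H" using cm by (auto simp: tensors_def)
    then show "mat (fst t) i k * mat (snd t) i k' =
        (\<Sum>s<3. \<Sum>s'<3. grouplike s i k * grouplike s' i k' * (mat (fst t) 0 s * mat (snd t) 0 s'))"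
      by (simp add: mat_determined_by_row[of _ i] sum_product ac_simps)
  qed
  also have "\<dots> = (\<Sum>s<3. \<Sum>s'<3. grouplike s i k * grouplike s' i k' * (if s =
      s' then mat h 0 s else 0))"
    unfolding sum_list_sum_swap sum_list_const_mult by (simp add: mat_comult h)
  also have "\<dots> = (\<Sum>s<3. mat h 0 s * (grouplike s i k * grouplike s i k'))"
    by (simp add: sum_lessThan_3)
  finally show "(\<Sum>s<3. mat h 0 s * (grouplike s i k * grouplike s i k')) = (\<Sum>s<3.
      mat h 0 s * (if k = k' then grouplike s i k else 0))"
    by simp
qed

lemma mat_row_sum: "h \<in> carrier H \<Longrightarrow> i < 3 \<Longrightarrow> (\<Sum>k<3. mat h i k) = of_rat (counit H h)"
  using emb_act[of h i 1] by (simp add: act_alg_one)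

lemma grouplike_row_sum:
  assumes "s < 3" "i < 3"
  shows "(\<Sum>k<3. grouplike s i k) = 1"
proof (rule row_0_eqI[OF _ assms(1), where d = "\<lambda>s. 1"])
  fix h assume h: "h \<in> carrier H"
  have "(\<Sum>s<3. mat h 0 s * (\<Sum>k<3. grouplike s i k)) = (\<Sum>k<3. mat h i k)"
    unfolding mat_determined_by_row[OF h, of i] sum_distrib_left by (rule sum.swap)
  then show "(\<Sum>s<3. mat h 0 s * (\<Sum>k<3. grouplike s i k)) = (\<Sum>s<3. mat h 0 s * 1)"
    using mat_row_sum h assms by simp
qed

text \<open>Entries are 0 or 1, at most one per row is 1, and the row sum 1 coming from the counit
  excludes a zero row. This gives a self-map of the indices; bijectivity is not claimed.\<close>

lemma grouplike_permutation:
  assumes "s < 3" "i < 3"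
  shows "\<exists>m<3. \<forall>k<3. grouplike s i k = (if k = m then 1 else 0)"
proof -
  have "\<exists>m<3. grouplike s i m \<noteq> 0"
  proof (rule ccontr)
    assume "\<not> (\<exists>m<3. grouplike s i m \<noteq> 0)"
    then have "(\<Sum>k<3. grouplike s i k) = 0" by simp
    then show False using grouplike_row_sum[OF assms] by simp
  qed
  then obtain m where m: "m < 3" "grouplike s i m \<noteq> 0" by blast
  have "grouplike s i k = (if k = m then 1 else 0)" if "k < 3" for k
    using grouplike_idem[OF assms m(1) that] m(2) by (auto split: if_splits)
  then show ?thesis using m(1) by blast
qed

text \<open>Compare the coefficients of row 0 of h' in the two expansions of row i of the product of
  h' and h.\<close>

lemma grouplike_mult:
  assumes h: "h \<in> carrier H" and "t < 3" "i < 3"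
  shows "(\<Sum>j<3. grouplike t i j * mat h j k) = (\<Sum>s<3. mat h t s * grouplike s i k)"
proof (rule row_0_eqI[OF _ assms(2)])
  fix h' assume h': "h' \<in> carrier H"
  have "(\<Sum>t<3. mat h' 0 t * (\<Sum>j<3. grouplike t i j * mat h j k)) = (\<Sum>j<3. mat h' i j * mat h j k)"
    unfolding mat_determined_by_row[OF h', of i] sum_distrib_left sum_distrib_right
    by (subst sum.swap) (simp add: ac_simps)
  also have "\<dots> = mat (h' \<otimes> h) i k"
    using h h' assms by (simp add: mat_mult)
  also have "\<dots> = (\<Sum>s<3. (\<Sum>t<3. mat h' 0 t * mat h t s) * grouplike s i k)"
    by (subst mat_determined_by_row) (simp_all add: h h' mat_mult)
  also have "\<dots> = (\<Sum>t<3. mat h' 0 t * (\<Sum>s<3. mat h t s * grouplike s i k))"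
    unfolding sum_distrib_left sum_distrib_right by (subst sum.swap) (simp add: ac_simps)
  finally show "(\<Sum>t<3. mat h' 0 t * (\<Sum>j<3. grouplike t i j * mat h j k)) =
    (\<Sum>t<3. mat h' 0 t * (\<Sum>s<3. mat h t s * grouplike s i k))" .
qed

lemma grouplike_assoc:
  assumes "s < 3" "t < 3" "i < 3"
  shows "(\<Sum>j<3. grouplike t i j * grouplike s j k) = (\<Sum>u<3. grouplike s t u * grouplike u i k)"
proof (rule row_0_eqI[OF _ assms(1)])
  fix h assume h: "h \<in> carrier H"
  have "(\<Sum>s<3. mat h 0 s * (\<Sum>j<3. grouplike t i j * grouplike s j k)) = (\<Sum>j<3.
      grouplike t i j * mat h j k)"
    unfolding mat_determined_by_row[OF h, of _ k] sum_distrib_left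
    by (subst sum.swap) (simp add: ac_simps)
  also have "\<dots> = (\<Sum>u<3. mat h t u * grouplike u i k)"
    by (rule grouplike_mult[OF h assms(2,3)])
  also have "\<dots> = (\<Sum>s<3. mat h 0 s * (\<Sum>u<3. grouplike s t u * grouplike u i k))"
    unfolding mat_determined_by_row[OF h, of t] sum_distrib_left sum_distrib_right
    by (subst sum.swap) (simp add: ac_simps)
  finally show "(\<Sum>s<3. mat h 0 s * (\<Sum>j<3. grouplike t i j * grouplike s j k)) =
    (\<Sum>s<3. mat h 0 s * (\<Sum>u<3. grouplike s t u * grouplike u i k))" .
qed

text \<open>With \<open>m s i\<close> the image of i under the s-th group-like, m is the addition
  table of \<int>/3, so that \<open>mat h i k\<close> depends only on k - i modulo 3.\<close>

lemma mat_circulant: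
  assumes h: "h \<in> carrier H"
  shows "mat h 1 0 = mat h 0 2" "mat h 1 1 = mat h 0 0" "mat h 1 2 = mat h 0 1"
    "mat h 2 0 = mat h 0 1" "mat h 2 1 = mat h 0 2" "mat h 2 2 = mat h 0 0"
proof -
  obtain m where m: "\<And>s i. s < 3 \<Longrightarrow> i < 3 \<Longrightarrow> m s i < 3"
    "\<And>s i k. s < 3 \<Longrightarrow> i < 3 \<Longrightarrow> k < 3 \<Longrightarrow> grouplike s i k = (if k = m s i then 1 else 0)"
    using grouplike_permutation by metis
  have m0: "m 0 p = p" if "p < 3" for p
    using m(2)[of 0 p p] grouplike_0[of p p] that by (simp split: if_splits)
  have ms0: "m s 0 = s" if "s < 3" for s
    using m(2)[of s 0 s] grouplike_row_0[of s s] that by (simp split: if_splits)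
  have assoc: "m s (m t p) = m (m s t) p" if "s < 3" "t < 3" "p < 3" for s t p
  proof -
    let ?k = "m (m s t) p"
    have k: "?k < 3" using m(1) that by simp
    have "(\<Sum>j<3. grouplike t p j * grouplike s j ?k) = (\<Sum>j<3. if j =
        m t p then grouplike s j ?k else 0)"
      by (intro sum.cong HOL.refl) (simp add: m(2) that)
    moreover have "(\<Sum>u<3. grouplike s t u * grouplike u p ?k) = (\<Sum>u<3. if u =
        m s t then grouplike u p ?k else 0)"
      by (intro sum.cong HOL.refl) (simp add: m(2)[of s t] that)
    ultimately have "grouplike s (m t p) ?k = grouplike (m s t) p ?k"
      using grouplike_assoc[OF that, of ?k] m(1) that by simp
    then show ?thesis using m k that by (simp split: if_splits)
  qed
  have surj: "\<exists>s<3. m s p = k" if "p < 3" "k < 3" for p k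
  proof (rule ccontr)
    assume c: "\<not> (\<exists>s<3. m s p = k)"
    \<comment> \<open>If no group-like sends p to k, then entry (p, k) vanishes on all of
      \<open>H\<close>, contradicting \<open>mat_rows_span\<close>.\<close>
    have "mat h' p k = 0" if "h' \<in> carrier H" for h'
      unfolding mat_determined_by_row[OF that, of p k]
      using c m(2) \<open>p < 3\<close> \<open>k < 3\<close> by (intro sum.neutral) auto
    then have "(\<Sum>s<3. mat h' p s * (if s = k then 1 else 0)) = 0" if "h' \<in> carrier H" for h'
      using that by (intro sum.neutral) auto
    from mat_rows_span[OF \<open>p < 3\<close> this \<open>k < 3\<close>] show False by simp
  qed
  note g = three_element_group[of m, OF m(1) m0 ms0 assoc surj]
  have "mat h i k = (\<Sum>s<3. mat h 0 s * (if k = m s i then 1 else 0))" if "i < 3" "k < 3" for i k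
    unfolding mat_determined_by_row[OF h, of i k]
    by (intro sum.cong HOL.refl) (simp add: m(2) that)
  note this[unfolded sum_lessThan_3]
  from this[of 1 0] this[of 1 1] this[of 1 2] this[of 2 0] this[of 2 1] this[of 2 2]
  show "mat h 1 0 = mat h 0 2" "mat h 1 1 = mat h 0 0" "mat h 1 2 = mat h 0 1"
    "mat h 2 0 = mat h 0 1" "mat h 2 1 = mat h 0 2" "mat h 2 2 = mat h 0 0"
    using g m0[of 1] m0[of 2] by simp_all
qed

text \<open>With \<open>\<delta>\<close> the square root of the discriminant below, the circulant matrix acts on the elements
  of trace zero as \<open>x + y R\<close>, where \<open>R = \<delta> (\<sigma> - \<sigma>\<^sup>2)\<close> is defined over the rationals.\<close>

lemma act_shape:
  assumes h: "h \<in> carrier H"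
  shows "\<exists>x y. act h \<alpha> = elt (- 4 * of_int a ^ 2 * y) (x + 9 * of_int b * y) (6 * of_int a * y) \<and>
    act h (\<alpha> ^ 2) = elt (2 * of_int a / 3 * (counit H h - x + 9 * of_int b * y))
      (- 2 * of_int a ^ 2 * y) (x - 9 * of_int b * y)"
proof -
  define A B where "A = (of_int a :: complex)" and "B = (of_int b :: complex)"
  define \<delta> where "\<delta> = - ((r 0 - r 1) * (r 1 - r 2) * (r 2 - r 0))"
  define e where "e = (of_rat (counit H h) :: complex)"
  \<comment> \<open>Subtracting the mean of the two off-diagonal entries removes a multiple of the
    trace, which kills trace-zero elements; X and \<delta> Y are the symmetric and antisymmetric
    remainders.\<close>
  define X where "X = mat h 0 0 - (mat h 0 1 + mat h 0 2) / 2"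
  define Y where "Y = (mat h 0 1 - mat h 0 2) / (2 * \<delta>)"
  have d: "\<delta> \<noteq> 0" by (simp add: \<delta>_def r_eq_iff)
  have e: "e = mat h 0 0 + mat h 0 1 + mat h 0 2"
    using mat_row_sum[OF h, of 0] by (simp add: e_def sum_lessThan_3)
  have Y: "mat h 0 1 - mat h 0 2 = 2 * \<delta> * Y" using d by (simp add: Y_def)
  have A: "A = r 0 ^ 2 + r 0 * r 1 + r 1 ^ 2" by (simp add: A_def r_quadratic)
  have B: "B = r 0 * r 1 * (r 0 + r 1)"
    using r_cube[of 0] A by (simp add: A_def B_def algebra_simps power2_eq_square power3_eq_cube)
  have r2: "r 2 = - r 0 - r 1" using r_sum by (simp add: eq_diff_eq add_eq_0_iff ac_simps)
  have m1: "mat h 0 1 = (e - X) / 3 + \<delta> * Y" and m2: "mat h 0 2 = (e - X) / 3 - \<delta> * Y"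
    and m0: "mat h 0 0 = (e + 2 * X) / 3"
    using Y by (simp_all add: e X_def field_simps)
  have em: "emb (r i) (act h (\<alpha> ^ n)) = mat h i 0 * r 0 ^ n + mat h i 1 * r 1 ^ n +
      mat h i 2 * r 2 ^ n"
    if "i < 3" for i n
    using that by (simp add: emb_act h emb_power r_cube sum_lessThan_3)
  have lt: "i = 0 \<or> i = 1 \<or> i = 2" if "i < 3" for i :: nat using that by auto
  \<comment> \<open>The three rows of the circulant matrix give one identity in cyclically rotated
    roots; \<delta>, A and B are invariant under the rotation.\<close>
  have par0: "r 2 = - r 0 - r 1" "\<delta> = - ((r 0 - r 1) * (r 1 - r 2) * (r 2 - r 0))"
    "A = r 0 ^ 2 + r 0 * r 1 + r 1 ^ 2" "B = r 0 * r 1 * (r 0 + r 1)"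
    by (simp_all only: r2 \<delta>_def A B)
  have par1: "r 0 = - r 1 - r 2" "\<delta> = - ((r 1 - r 2) * (r 2 - r 0) * (r 0 - r 1))"
    "A = r 1 ^ 2 + r 1 * r 2 + r 2 ^ 2" "B = r 1 * r 2 * (r 1 + r 2)"
    by (simp_all add: r2 \<delta>_def A B algebra_simps power2_eq_square)
  have par2: "r 1 = - r 2 - r 0" "\<delta> = - ((r 2 - r 0) * (r 0 - r 1) * (r 1 - r 2))"
    "A = r 2 ^ 2 + r 2 * r 0 + r 0 ^ 2" "B = r 2 * r 0 * (r 2 + r 0)"
    by (simp_all add: r2 \<delta>_def A B algebra_simps power2_eq_square)
  have m3: "3 * mat h 0 0 = e + 2 * X" "3 * mat h 0 1 = e - X + 3 * \<delta> * Y" "3 * mat h 0 2 =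
      e - X - 3 * \<delta> * Y"
    unfolding m0 m1 m2 by (simp_all add: field_simps)
  note on_roots = circulant_on_roots[OF par0 m3] circulant_on_roots[OF par1 m3]
      circulant_on_roots[OF par2 m3]
  have e1: "emb (r i) (act h (\<alpha> ^ 1)) = - 4 * A ^ 2 * Y + (X + 9 * B * Y) * r i +
      6 * A * Y * r i ^ 2" if "i < 3" for i
    using lt[OF that]
  proof (elim disjE)
    assume i: "i = 0"
    show ?thesis unfolding em[OF that] unfolding i power_one_right on_roots[symmetric] ..
  next
    assume i: "i = 1"
    show ?thesis unfolding em[OF that]
      unfolding i power_one_right on_roots[symmetric] mat_circulant[OF h] by (simp only: ac_simps)
  next
    assume i: "i = 2"
    show ?thesis unfolding em[OF that]
      unfolding i power_one_right on_roots[symmetric] mat_circulant[OF h] by (simp only: ac_simps)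
  qed
  have e2: "3 * emb (r i) (act h (\<alpha> ^ 2)) = 2 * A * (e - X + 9 * B * Y) - 6 * A ^ 2 * Y * r i +
      3 * (X - 9 * B * Y) * r i ^ 2" if "i < 3" for i
    using lt[OF that]
  proof (elim disjE)
    assume i: "i = 0"
    show ?thesis unfolding em[OF that] unfolding i on_roots[symmetric] ..
  next
    assume i: "i = 1"
    show ?thesis unfolding em[OF that] unfolding i on_roots[symmetric] mat_circulant[OF h]
      by (simp only: ac_simps)
  next
    assume i: "i = 2"
    show ?thesis unfolding em[OF that] unfolding i on_roots[symmetric] mat_circulant[OF h]
      by (simp only: ac_simps)
  qed
  obtain c0 c1 c2 where c: "act h \<alpha> = elt c0 c1 c2" using act_closed[OF h L_simps(3)]
    by (rule L_cases)
  obtain d0 d1 d2 where d: "act h (\<alpha> ^ 2) = elt d0 d1 d2" using act_closed[OF h L_simps(4)]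
    by (rule L_cases)
  have "of_rat c0 - (- 4 * A ^ 2 * Y) = 0 \<and> of_rat c1 - (X + 9 * B * Y) = 0 \<and>
      of_rat c2 - 6 * A * Y = 0"
    by (rule vandermonde_zero[OF r_inj]) (use e1 in \<open>simp add: c emb_elt algebra_simps\<close>)
  then have cc: "of_rat c0 = - 4 * A ^ 2 * Y" "of_rat c1 = X + 9 * B * Y" "of_rat c2 = 6 * A * Y"
    by (simp_all add: eq_neg_iff_add_eq_0)
  have "3 * of_rat d0 - 2 * A * (e - X + 9 * B * Y) = 0 \<and> 3 * (of_rat d1 - (- 2 * A ^ 2 * Y)) = 0 \<and>
      3 * (of_rat d2 - (X - 9 * B * Y)) = 0"
    by (rule vandermonde_zero[OF r_inj]) (use e2 in \<open>simp add: d emb_elt algebra_simps\<close>)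
  then have dd: "3 * of_rat d0 = 2 * A * (e - X + 9 * B * Y)" "of_rat d1 = - 2 * A ^ 2 * Y"
    "of_rat d2 = X - 9 * B * Y"
    by (simp_all only: mult_eq_0_iff right_minus_eq numeral_neq_zero simp_thms)
  \<comment> \<open>Rationality of X and Y: the rational numbers c1 and d2 equal X + 9 B Y and X - 9
    B Y, and b is nonzero.\<close>
  define x where "x = (c1 + d2) / 2"
  define y where "y = (c1 - d2) / (18 * of_int b)"
  have B0: "B \<noteq> 0" using b_nonzero by (simp add: B_def)
  have x: "of_rat x = X" by (simp add: x_def of_rat_divide of_rat_add cc dd)
  have y: "of_rat y = Y" using B0
    by (simp add: y_def of_rat_divide of_rat_diff of_rat_mult cc dd B_def)
  have "c0 = - 4 * of_int a ^ 2 * y" "c1 = x + 9 * of_int b * y" "c2 = 6 * of_int a * y"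
    "3 * d0 = 2 * of_int a * (counit H h - x + 9 * of_int b * y)"
    "d1 = - 2 * of_int a ^ 2 * y" "d2 = x - 9 * of_int b * y"
    unfolding of_rat_eq_iff[where 'a = complex, symmetric]
    by (simp_all only: of_rat_mult of_rat_add of_rat_diff of_rat_minus of_rat_power
        of_rat_numeral_eq
        of_rat_of_int_eq x y cc dd flip: A_def B_def e_def)
  then show ?thesis unfolding c d elt_inject
    by - (rule exI[of _ x], rule exI[of _ y], simp add: field_simps)
qed

end

section \<open>The Hopf algebra in rational coordinates\<close>

context cubic_hopf_galois
begin

text \<open>The images of \<open>\<alpha>\<close> and \<open>\<alpha>\<^sup>2\<close> under the operator that is multiplication by \<open>e\<close> on \<open>\<rat>\<close> and
  \<open>x + y R\<close> on the elements of trace zero.\<close>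

definition op1 :: "rat \<Rightarrow> rat \<Rightarrow> 'k" where
  "op1 x y = elt (- 4 * of_int a ^ 2 * y) (x + 9 * of_int b * y) (6 * of_int a * y)"

definition op2 :: "rat \<Rightarrow> rat \<Rightarrow> rat \<Rightarrow> 'k" where
  "op2 e x y = elt (2 * of_int a / 3 * (e - x + 9 * of_int b * y))
      (- 2 * of_int a ^ 2 * y) (x - 9 * of_int b * y)"

lemma act_op:
  assumes "h \<in> carrier H"
  shows "\<exists>x y. act h \<alpha> = op1 x y \<and> act h (\<alpha> ^ 2) = op2 (counit H h) x y"
proof -
  obtain r :: "nat \<Rightarrow> complex" where "inj_on r {..<3}" "\<And>i. i < 3 \<Longrightarrow> r i ^ 3 =
      of_int a * r i - of_int b"
    using complex_roots_exist by blast
  then interpret cubic_hopf_galois_roots a b \<alpha> H act r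
    by unfold_locales
  show ?thesis using act_shape[OF assms] by (simp add: op1_def op2_def)
qed

lemma act_elt:
  assumes "h \<in> carrier H"
  shows "act h (elt u v w) = of_rat u * of_rat (counit H h) + of_rat v * act h \<alpha> +
      of_rat w * act h (\<alpha> ^ 2)"
proof -
  have "elt u v w = of_rat u + (of_rat v * \<alpha> + of_rat w * \<alpha> ^ 2)" by (simp add: elt_def)
  moreover have "of_rat u \<in> L" by (metis elt_simps(5) elt_in_L)
  moreover have "act h (of_rat u) = of_rat u * of_rat (counit H h)"
    using act_scale[of h 1 u] assms by (simp add: act_alg_one)
  ultimately show ?thesis
    using assms by (simp add: act_additive act_scale L_closed)
qed

lemma op1_eq: "op1 x y = of_rat x * \<alpha> + of_rat y * op1 0 1"
proof -
  have "op1 x y = elt 0 x 0 + of_rat y * op1 0 1"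
    unfolding op1_def elt_scale elt_add elt_inject by simp
  then show ?thesis by (simp add: elt_def)
qed

text \<open>As \<alpha>^2 has trace 2a, the element 3 \<alpha>^2 - 2a has trace zero, and
  \<open>3 * op2 0 0 1\<close> is its image under R.\<close>

lemma op2_eq: "3 * op2 e x y = 2 * of_int a * of_rat e + of_rat x * (3 * \<alpha> ^ 2 - 2 * of_int a)
    + of_rat y * (3 * op2 0 0 1)"
proof -
  have "of_rat 3 * op2 e x y = elt (2 * of_int a * e) 0 0 + of_rat x * elt (- 2 * of_int a) 0 3 +
      of_rat y * (of_rat 3 * op2 0 0 1)"
    unfolding op2_def elt_scale elt_add elt_inject by (simp add: field_simps)
  moreover have "elt (2 * of_int a * e) 0 0 = 2 * of_int a * of_rat e"
      "elt (- 2 * of_int a) 0 3 = 3 * \<alpha> ^ 2 - 2 * of_int a"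
    by (simp_all add: elt_def of_rat_mult of_rat_minus)
  ultimately show ?thesis by simp
qed

text \<open>The determinant formed by two trace-zero elements and their images under R. Its being
  nonzero makes x and y recoverable even when they are allowed to lie in \<open>L\<close>.\<close>

lemma op_determinant: "\<alpha> * (3 * op2 0 0 1) - (3 * \<alpha> ^ 2 - 2 * of_int a) * op1 0 1 =
    - 2 * of_int disc"
proof -
  have ge: "\<alpha> * (3 * (2 * A / 3 * (9 * B) + (- 2 * A ^ 2) * \<alpha> + (- 9 * B) * \<alpha> ^ 2)) -
     (3 * \<alpha> ^ 2 - 2 * A) * (- 4 * A ^ 2 + 9 * B * \<alpha> + 6 * A * \<alpha> ^ 2) =
         - 2 * (4 * A ^ 3 - 27 * B ^ 2)"
    if "\<alpha> ^ 3 = A * \<alpha> - B" for A B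
  proof -
    have "3 * (2 * A / 3 * (9 * B) + (- 2 * A ^ 2) * \<alpha> + (- 9 * B) * \<alpha> ^ 2) =
      18 * A * B - 6 * A ^ 2 * \<alpha> - 27 * B * \<alpha> ^ 2" by (simp add: algebra_simps)
    then show ?thesis using that by Groebner_Basis.algebra
  qed
  from ge[OF root_cube] show ?thesis
    by (simp add: op1_def op2_def elt_def disc_def of_rat_minus of_rat_mult of_rat_power)
qed

lemma combination:
  assumes "u \<in> tensors (field_alg L) H"
  shows "\<exists>h\<in>carrier H. \<forall>y\<in>L. act h y = (\<Sum>t\<leftarrow>u. of_rat (coord 0 (fst t)) * act (snd t) y)"
  using assms
proof (induction u)
  case Nil
  have "act (0 \<odot> \<one>) y = 0" if "y \<in> L" for y using that by (simp add: act_smult_left)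
  then show ?case by (intro bexI[of _ "0 \<odot> \<one>"]) auto
next
  case (Cons t u)
  then obtain h where "h \<in> carrier H" "\<forall>y\<in>L. act h y = (\<Sum>t\<leftarrow>u.
      of_rat (coord 0 (fst t)) * act (snd t) y)"
    by auto
  with Cons.prems show ?case
    by (intro bexI[of _ "coord 0 (fst t) \<odot> snd t \<oplus> h"]) (auto simp: act_add_left act_smult_left)
qed

lemma coord_sum_list:
  assumes "u \<in> tensors (field_alg L) H"
  shows "(\<Sum>t\<leftarrow>u. fst t * of_rat (f (snd t))) \<in> L \<and>
    of_rat (coord 0 (\<Sum>t\<leftarrow>u. fst t * of_rat (f (snd t)))) = (\<Sum>t\<leftarrow>u.
        of_rat (coord 0 (fst t)) * (of_rat (f (snd t)) :: 'k))"
  using assms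
proof (induction u)
  case (Cons t u)
  have c: "fst t * of_rat (f (snd t)) = of_rat (f (snd t)) * fst t" by (rule mult.commute)
  show ?case
    using Cons unfolding list.map sum_list.Cons c
    by (auto simp: coord_add coord_scale L_closed of_rat_add of_rat_mult mult.commute[of "of_rat
        (coord 0 (fst t))"])
qed simp

text \<open>Replaces a dimension count. The prescribed endomorphism has a preimage in L \<otimes> H;
  weighting the parameters of its H-entries by the L-coefficients must return e, x, y, by
  \<open>op_determinant\<close>. Applying \<open>coord 0\<close> to the coefficients then gives an
  element of \<open>H\<close> with the same parameters.\<close>

lemma op_surj: "\<exists>h\<in>carrier H. counit H h = e \<and> act h \<alpha> = op1 x y \<and> act h (\<alpha> ^ 2) = op2 e x y"
proof -
  obtain X Y where XY: "\<And>h. h \<in> carrier H \<Longrightarrow> act h \<alpha> = op1 (X h) (Y h) \<and> act h (\<alpha> ^ 2) =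
      op2 (counit H h) (X h) (Y h)"
    using act_op by metis
  define \<phi> where "\<phi> z = of_rat (coord 0 z) * of_rat e + of_rat (coord 1 z) * op1 x y +
      of_rat (coord 2 z) * op2 e x y" for z
  have "of_rat c \<in> L" for c by (metis elt_simps(5) elt_in_L)
  then have "\<phi> \<in> rat_endos L"
    by (auto simp: rat_endos_def \<phi>_def op1_def op2_def coord_add coord_scale of_rat_add of_rat_mult
        intro!: L_closed(1,3)) (simp_all add: algebra_simps)
  then obtain u where u: "u \<in> tensors (field_alg L) H" "\<And>z. z \<in> L \<Longrightarrow> galois_map act u z = \<phi> z"
    using galois_surj by blast
  \<comment> \<open>With f the identity these sums describe the Galois map of u; with f the
    functional \<open>coord 0\<close> they describe the descended element of
    \<open>H\<close>.\<close>
  define S :: "('k \<Rightarrow> 'k) \<Rightarrow> ('h \<Rightarrow> rat) \<Rightarrow> 'k" where "S f F = (\<Sum>t\<leftarrow>u. f (fst t) * of_rat (F (snd t)))"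
    for f F
  have S1: "(\<Sum>t\<leftarrow>u. f (fst t) * act (snd t) 1) = S f (counit H)" 
    and S2: "(\<Sum>t\<leftarrow>u. f (fst t) * act (snd t) \<alpha>) = S f X * \<alpha> + S f Y * op1 0 1"
    and S3: "3 * (\<Sum>t\<leftarrow>u. f (fst t) * act (snd t) (\<alpha> ^ 2)) =
      2 * of_int a * S f (counit H) + S f X * (3 * \<alpha> ^ 2 - 2 * of_int a) +
          S f Y * (3 * op2 0 0 1)" for f
  proof -
    show "(\<Sum>t\<leftarrow>u. f (fst t) * act (snd t) 1) = S f (counit H)"
      unfolding S_def using u(1) by (induction u) (auto simp: act_alg_one)
    show "(\<Sum>t\<leftarrow>u. f (fst t) * act (snd t) \<alpha>) = S f X * \<alpha> + S f Y * op1 0 1"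
      unfolding S_def using u(1) by (induction u) (auto simp: XY op1_eq[of "X _"] algebra_simps)
    have "3 * (f t * op2 e x y) = f t * (2 * of_int a * of_rat e +
        of_rat x * (3 * \<alpha> ^ 2 - 2 * of_int a)
        + of_rat y * (3 * op2 0 0 1))" for t e x y
      unfolding op2_eq[symmetric] by (simp add: algebra_simps)
    then show "3 * (\<Sum>t\<leftarrow>u. f (fst t) * act (snd t) (\<alpha> ^ 2)) =
      2 * of_int a * S f (counit H) + S f X * (3 * \<alpha> ^ 2 - 2 * of_int a) + S f Y * (3 * op2 0 0 1)"
      unfolding S_def using u(1)
      by (induction u) (auto simp: XY distrib_left, simp add: algebra_simps)
  qed
  have gm: "galois_map act u z = (\<Sum>t\<leftarrow>u. fst t * act (snd t) z)" for z
    by (simp add: galois_map_def split_def)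
  have "coord i 1 = (if i = 0 then 1 else 0)" "coord i \<alpha> = (if i = Suc 0 then 1 else 0)"
    "coord i (\<alpha> ^ 2) = (if i = 2 then 1 else 0)" if "i < 3" for i
    using that coord_power[of i 0] coord_power[of i 1] coord_power[of i 2] by auto
  then have \<phi>: "\<phi> 1 = of_rat e" "\<phi> \<alpha> = op1 x y" "\<phi> (\<alpha> ^ 2) = op2 e x y"
    by (simp_all add: \<phi>_def)
  have e: "S (\<lambda>z. z) (counit H) = of_rat e"
    using u(2)[of 1] S1[of "\<lambda>z. z"] by (simp add: \<phi> gm)
  have d1: "(S (\<lambda>z. z) X - of_rat x) * \<alpha> + (S (\<lambda>z. z) Y - of_rat y) * op1 0 1 = 0"
    using u(2)[of \<alpha>] S2[of "\<lambda>z. z"] by (simp add: \<phi> gm op1_eq[of x y] algebra_simps)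
  have d2: "(S (\<lambda>z. z) X - of_rat x) * (3 * \<alpha> ^ 2 - 2 * of_int a) + (S (\<lambda>z.
      z) Y - of_rat y) * (3 * op2 0 0 1) = 0"
  proof -
    have "2 * of_int a * S (\<lambda>z. z) (counit H) + S (\<lambda>z. z) X * (3 * \<alpha> ^ 2 - 2 * of_int a) + S (\<lambda>z.
        z) Y * (3 * op2 0 0 1) = 3 * op2 e x y"
      using u(2)[of "\<alpha> ^ 2"] S3[of "\<lambda>z. z"] by (simp only: \<phi> gm L_simps)
    then show ?thesis unfolding op2_eq[of e x y] e by (simp add: algebra_simps)
  qed
  have "(S (\<lambda>z. z) Y - of_rat y) * (\<alpha> * (3 * op2 0 0 1) - (3 * \<alpha> ^ 2 - 2 * of_int a) * op1 0 1) = 0"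
    using d1 d2 by Groebner_Basis.algebra
  then have Y: "S (\<lambda>z. z) Y = of_rat y"
    unfolding op_determinant using disc_nonzero by simp
  moreover have "\<alpha> \<noteq> 0" using elt_eq_0[of 0 1 0] by (auto simp: elt_simps)
  ultimately have X: "S (\<lambda>z. z) X = of_rat x" using d1 by simp
  have S0: "S (\<lambda>z. of_rat (coord 0 z)) F = of_rat (coord 0 (S (\<lambda>z. z) F))" for F
    using coord_sum_list[OF u(1), of F] by (simp add: S_def)
  have c0: "coord 0 (of_rat c) = c" for c by (metis coord_simps(1) elt_simps(5))
  obtain h where h: "h \<in> carrier H" "\<And>y. y \<in> L \<Longrightarrow> act h y = (\<Sum>t\<leftarrow>u.
      of_rat (coord 0 (fst t)) * act (snd t) y)"
    using combination[OF u(1)] by blast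
  note S1[of "\<lambda>z. of_rat (coord 0 z)", unfolded S0 e X Y c0]
    and S2[of "\<lambda>z. of_rat (coord 0 z)", unfolded S0 e X Y c0, folded op1_eq]
    and S3[of "\<lambda>z. of_rat (coord 0 z)", unfolded S0 e X Y c0, folded op2_eq]
  note this[folded h(2)[OF L_simps(2)] h(2)[OF L_simps(3)] h(2)[OF L_simps(4)]]
  then show ?thesis using h(1) by (intro bexI[of _ h]) (auto simp: act_alg_one)
qed

text \<open>The map L \<otimes> H \<rightarrow> H induced by \<open>coord 0\<close> on the first
  factor. It sends 1 \<otimes> h back to h, which turns injectivity of the Galois map into
  faithfulness of the action.\<close>

definition collapse :: "('k \<times> 'h) list \<Rightarrow> 'h" where
  "collapse u = foldr (\<lambda>t s. (coord 0 (fst t) \<odot> snd t) \<oplus> s) u \<zero>"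

lemma collapse_simps [simp]: "collapse [] = \<zero>" "collapse (t # u) =
    (coord 0 (fst t) \<odot> snd t) \<oplus> collapse u"
  by (simp_all add: collapse_def)

lemma collapse_closed: "u \<in> tensors (field_alg L) H \<Longrightarrow> collapse u \<in> carrier H"
  by (induction u) auto

lemma collapse_append: "u \<in> tensors (field_alg L) H \<Longrightarrow> v \<in> tensors (field_alg L) H \<Longrightarrow>
    collapse (u @ v) = collapse u \<oplus> collapse v"
  by (induction u) (auto simp: collapse_closed a_assoc)

lemma smult_rat:
  "x \<in> carrier H \<Longrightarrow> (c + d) \<odot> x = c \<odot> x \<oplus> d \<odot> x"
  "x \<in> carrier H \<Longrightarrow> y \<in> carrier H \<Longrightarrow> c \<odot> (x \<oplus> y) = c \<odot> x \<oplus> c \<odot> y"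
  "x \<in> carrier H \<Longrightarrow> (c * d) \<odot> x = d \<odot> (c \<odot> x)"
  "x \<in> carrier H \<Longrightarrow> 0 \<odot> x = \<zero>" "x \<in> carrier H \<Longrightarrow> 1 \<odot> x = x"
  using V.smult_l_distr[of c d x] V.smult_r_distr[of c x y] V.smult_assoc1[of d c x]
      V.smult_l_null[of x] V.smult_one[of x]
  by (simp_all add: rat_ring_def mult.commute)

text \<open>The congruence also relates formal sums with entries outside the carriers, hence the
  membership claim.\<close>

lemma collapse_cong:
  assumes "tensor_eq (field_alg L) H u v"
  shows "(u \<in> tensors (field_alg L) H \<longleftrightarrow> v \<in> tensors (field_alg L) H) \<and>
    (u \<in> tensors (field_alg L) H \<longrightarrow> collapse u = collapse v)"
  using assms
proof induction
  case (gen u v)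
  then show ?case
    by cases (auto simp: field_alg_def coord_add coord_scale smult_rat L_closed)
next
  case (comm u v)
  then show ?case by (auto simp: collapse_append collapse_closed a_comm)
next
  case (add u v w)
  then show ?case by (auto simp: collapse_append)
qed auto

lemma act_faithful:
  assumes h: "h \<in> carrier H" and "\<And>y. y \<in> L \<Longrightarrow> act h y = 0"
  shows "h = \<zero>"
proof -
  have "tensor_eq (field_alg L) H [(1, h)] []"
    using assms by (intro galois_inj) auto
  from collapse_cong[OF this] h have "coord 0 1 \<odot> h \<oplus> \<zero> = \<zero>" by simp
  moreover have "coord 0 1 = 1" using coord_power[of 0 0] by simp
  ultimately show ?thesis using h by (simp add: smult_rat)
qed

end

section \<open>The associated order\<close>

text \<open>Put S = x - 9by, the last coordinate of the image of \<alpha>^2. Preserving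
  \<open>int_adjoin \<alpha>\<close> requires S, 18by, 6ay, 2a^2 y and 2a(counit - S)/3 to be
  integers. So n y is an integer, and counit - S is a multiple of c; k is the resulting step of the
  constant coefficient.\<close>

locale cubic_hopf_galois_order = cubic_hopf_galois a b \<alpha> H act
  for a b :: int and \<alpha> :: "'k::field_char_0" and H :: "('h, 'm) hopf_scheme" (structure)
    and act :: "'h \<Rightarrow> 'k \<Rightarrow> 'k" +
  fixes n r s q c k :: int
  assumes n: "n = gcd (gcd (18 * b) (6 * a)) (2 * a ^ 2)"
    and r: "18 * b = n * r" and s: "6 * a = n * s" and q: "2 * a ^ 2 = n * q"
    and k: "2 * a * c = 3 * k"
    and c: "c = (if 3 dvd a then 1 else 3)"
begin

lemma n_nonzero: "n \<noteq> 0"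
  using n b_nonzero by simp

text \<open>In the rational coordinates of \<open>op1\<close>, \<open>op2\<close> this is \<open>y = t / n\<close>, \<open>x = S + 9 b y\<close> and
  counit \<open>S + c e\<close>.\<close>

definition order_coords :: "int \<Rightarrow> int \<Rightarrow> int \<Rightarrow> 'h \<Rightarrow> bool" where
  "order_coords e S t h \<longleftrightarrow> h \<in> carrier H \<and> counit H h = of_int (S + c * e) \<and>
    act h \<alpha> = elt (of_int (- 2 * q * t)) (of_int (S + r * t)) (of_int (s * t)) \<and>
    act h (\<alpha> ^ 2) = elt (of_int (k * e)) (of_int (- q * t)) (of_int S)"

lemma order_coords_op:
  fixes e S t :: int and x y :: rat
  assumes "of_int n * y = of_int t" "x = of_int S + 9 * of_int b * y" "\<epsilon> = of_int (S + c * e)"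
  shows "op1 x y = elt (of_int (- 2 * q * t)) (of_int (S + r * t)) (of_int (s * t))"
    and "op2 \<epsilon> x y = elt (of_int (k * e)) (of_int (- q * t)) (of_int S)"
proof -
  have "(of_int (18 * b) :: rat) = of_int (n * r)" "(of_int (6 * a) :: rat) = of_int (n * s)"
    "(of_int (2 * a ^ 2) :: rat) = of_int (n * q)" "(of_int (2 * a * c) :: rat) = of_int (3 * k)"
    by (simp_all only: r s q k)
  then have eq: "18 * of_int b = (of_int n * of_int r :: rat)" "6 * of_int a =
      (of_int n * of_int s :: rat)"
    "2 * of_int a ^ 2 = (of_int n * of_int q :: rat)" "2 * of_int a * of_int c =
        (3 * of_int k :: rat)"
    by simp_all
  have y: "18 * of_int b * y = of_int r * of_int t" "6 * of_int a * y = of_int s * of_int t"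
    "2 * of_int a ^ 2 * y = of_int q * of_int t"
    unfolding eq assms(1)[symmetric] by (simp_all only: ac_simps)
  show "op1 x y = elt (of_int (- 2 * q * t)) (of_int (S + r * t)) (of_int (s * t))"
    unfolding op1_def elt_inject using y assms(2)
    by (simp only: of_int_add of_int_mult of_int_minus of_int_numeral mult_minus_left mult.assoc)
        linarith
  have "2 * of_int a / 3 * (\<epsilon> - x + 9 * of_int b * y) = of_int k * (of_int e :: rat)"
    using eq(4) assms(2,3) by (simp add: field_simps)
  then show "op2 \<epsilon> x y = elt (of_int (k * e)) (of_int (- q * t)) (of_int S)"
    unfolding op2_def elt_inject using y assms(2)
    by (simp only: of_int_add of_int_mult of_int_minus of_int_numeral mult_minus_left mult.assoc)
        linarith
qed

lemma order_coords_exists: "\<exists>h. order_coords e S t h"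
proof -
  define y where "y = of_int t / (of_int n :: rat)"
  have y: "of_int n * y = of_int t" using n_nonzero by (simp add: y_def)
  obtain h where "h \<in> carrier H" "counit H h = of_int (S + c * e)"
    "act h \<alpha> = op1 (of_int S + 9 * of_int b * y) y"
    "act h (\<alpha> ^ 2) = op2 (of_int (S + c * e)) (of_int S + 9 * of_int b * y) y"
    using op_surj by blast
  with order_coords_op[where S = S and e = e, OF y HOL.refl HOL.refl] show ?thesis
    unfolding order_coords_def by metis
qed

text \<open>In the coordinates (e, S, t) the map h \<mapsto> h \<cdot> \<theta> is block triangular:
  the entry \<open>u * c + w * k\<close> and the 2 by 2 block with rows (v, r v - q w) and (w, s
  v).\<close>

lemma order_coords_act:
  assumes "order_coords e S t h"
  shows "act h (elt (of_int u) (of_int v) (of_int w)) =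
    elt (of_int ((u * c + w * k) * e + u * S - 2 * q * v * t))
        (of_int (v * S + (r * v - q * w) * t)) (of_int (w * S + s * v * t))"
proof -
  have h: "h \<in> carrier H" using assms by (simp add: order_coords_def)
  have cu: "of_rat (counit H h) = elt (of_int (S + c * e)) 0 0"
    using assms by (simp add: order_coords_def elt_simps)
  have 1: "act h \<alpha> = elt (of_int (- 2 * q * t)) (of_int (S + r * t)) (of_int (s * t))"
    and 2: "act h (\<alpha> ^ 2) = elt (of_int (k * e)) (of_int (- q * t)) (of_int S)"
    using assms by (simp_all only: order_coords_def)
  show ?thesis
    unfolding act_elt[OF h] cu 1 2 elt_scale elt_add elt_inject by (simp add: algebra_simps)
qed

lemma order_coords_zero:
  assumes "order_coords 0 0 0 h"
  shows "h = \<zero>"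
proof (rule act_faithful)
  show h: "h \<in> carrier H" using assms by (simp add: order_coords_def)
  fix y assume "y \<in> L"
  then obtain u v w where "y = elt u v w" by (rule L_cases)
  then show "act h y = 0"
    using assms unfolding order_coords_def by (simp add: act_elt h elt_simps)
qed

lemma order_coords_nonzero:
  assumes "order_coords e S t h" "h = \<zero>"
  shows "e = 0 \<and> S = 0 \<and> t = 0"
proof -
  have z: "act h y = 0" if "y \<in> L" for y
  proof -
    have "act (0 \<odot> \<one>) y = 0" using that by (simp add: act_smult_left)
    then show ?thesis using assms by (simp add: smult_rat)
  qed
  have "act h (elt (of_int 1) (of_int 0) (of_int 0)) = 0"
      "act h (elt (of_int 0) (of_int 1) (of_int 0)) = 0"
    "act h (elt (of_int 0) (of_int 0) (of_int 1)) = 0" by (simp_all only: z elt_in_L)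
  note this[unfolded order_coords_act[OF assms(1)]]
  from this[THEN elt_eq_0] have "c * e + S = 0" "r * t + S = 0" "s * t = 0" "q * t = 0" "S = 0"
    by simp_all
  moreover have "c \<noteq> 0" by (simp add: c)
  moreover have "r \<noteq> 0" using r b_nonzero by auto
  ultimately show ?thesis by simp
qed

lemma assoc_order_coords: "h \<in> assoc_order H act (int_adjoin \<alpha>) \<longleftrightarrow> (\<exists>e S t. order_coords e S t h)"
proof
  assume "\<exists>e S t. order_coords e S t h"
  then obtain e S t where p: "order_coords e S t h" by blast
  have "act h x \<in> int_adjoin \<alpha>" if x: "x \<in> int_adjoin \<alpha>" for x
  proof -
    obtain u v w where "x = elt (of_int u) (of_int v) (of_int w)"
      using x unfolding int_adjoin_eq by blast
    then show ?thesis using order_coords_act[OF p, of u v w] unfolding int_adjoin_eq by blast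
  qed
  then show "h \<in> assoc_order H act (int_adjoin \<alpha>)"
    using p by (simp add: assoc_order_def order_coords_def)
next
  assume A: "h \<in> assoc_order H act (int_adjoin \<alpha>)"
  then have h: "h \<in> carrier H" and int: "\<And>x. x \<in> int_adjoin \<alpha> \<Longrightarrow> act h x \<in> int_adjoin \<alpha>"
    by (auto simp: assoc_order_def)
  obtain x y where xy: "act h \<alpha> = op1 x y" "act h (\<alpha> ^ 2) = op2 (counit H h) x y"
    using act_op[OF h] by blast
  have "elt (of_int 1) (of_int 0) (of_int 0) \<in> int_adjoin \<alpha>"
      "elt (of_int 0) (of_int 1) (of_int 0) \<in> int_adjoin \<alpha>"
    "elt (of_int 0) (of_int 0) (of_int 1) \<in> int_adjoin \<alpha>"
    unfolding int_adjoin_eq by blast+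
  from this[THEN int] have "elt (counit H h) 0 0 \<in> int_adjoin \<alpha>" "op1 x y \<in> int_adjoin \<alpha>"
    "op2 (counit H h) x y \<in> int_adjoin \<alpha>"
    by (simp_all add: elt_simps act_alg_one h xy)
  then obtain E p0 p1 p2 q0 q1 S :: int where
    E: "counit H h = of_int E" and p: "x + 9 * of_int b * y = of_int p1" "6 * of_int a * y =
        of_int p2"
    and q': "2 * of_int a / 3 * (counit H h - x + 9 * of_int b * y) = of_int q0"
        "- 2 * of_int a ^ 2 * y = of_int q1"
    "x - 9 * of_int b * y = of_int S"
    unfolding int_adjoin_eq op1_def op2_def mem_Collect_eq elt_inject by blast
  obtain z1 z2 where z: "gcd (18 * b) (6 * a) = z1 * (18 * b) + z2 * (6 * a)"
    using bezout_int by metis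
  obtain z3 z4 where "n = z3 * gcd (18 * b) (6 * a) + z4 * (2 * a ^ 2)"
    unfolding n using bezout_int by metis
  then have n': "n = (z3 * z1) * (18 * b) + (z3 * z2) * (6 * a) + z4 * (2 * a ^ 2)"
    unfolding z by (simp add: algebra_simps)
  \<comment> \<open>By Bezout n is an integral combination of 18b, 6a and 2a^2, so n y is the same
    combination of the integers p1 - S, p2 and -q1.\<close>
  define t where "t = (z3 * z1) * (p1 - S) + (z3 * z2) * p2 - z4 * q1"
  have "of_int n * y = of_int (z3 * z1) * (18 * of_int b * y) +
      of_int (z3 * z2) * (6 * of_int a * y)
      - of_int z4 * (- 2 * of_int a ^ 2 * y)"
    unfolding n' by (simp add: algebra_simps)
  also have "18 * of_int b * y = of_int p1 - of_int S" unfolding p(1)[symmetric] q'(3)[symmetric]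
    by simp
  finally have t: "of_int n * y = of_int t" unfolding p(2) q'(2) t_def by simp
  have x: "x = of_int S + 9 * of_int b * y" using q'(3) by (simp add: algebra_simps)
  obtain e where e: "E = S + c * e"
  proof (cases "3 dvd a")
    case True
    then show ?thesis using that[of "E - S"] c by simp
  next
    case False
    have "(of_int (2 * a * (E - S)) :: rat) = of_int (3 * q0)"
      using q'(1) unfolding E x by (simp add: field_simps)
    then have "2 * a * (E - S) = 3 * q0" by (simp only: of_int_eq_iff)
    then have "3 dvd 2 * a * (E - S)" by simp
    moreover have "prime (3 :: int)" by simp
    moreover have "\<not> 3 dvd (2 :: int)" by simp
    ultimately have "3 dvd E - S" using False by (meson prime_dvd_mult_iff)
    then obtain e where "E - S = 3 * e" by (auto simp: dvd_def)
    then show ?thesis using that[of e] c False by simp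
  qed
  have "order_coords e S t h"
    unfolding order_coords_def xy using h order_coords_op[OF t x, of "counit H h" e] E e by simp
  then show "\<exists>e S t. order_coords e S t h" by blast
qed

text \<open>A basis may a priori have any size. Order and module both have rank 3, so it is a single
  element, and it generates freely iff the matrix of \<open>order_coords_act\<close> is invertible
  over \<int>.\<close>

lemma free_over_iff:
  "free_over H act (assoc_order H act (int_adjoin \<alpha>)) (int_adjoin \<alpha>) \<longleftrightarrow>
    (\<exists>u v w. \<bar>(u * c + w * k) * (s * v ^ 2 - r * v * w + q * w ^ 2)\<bar> = 1)"
  (is "free_over H act ?A ?O \<longleftrightarrow> _")
proof
  let ?z = "\<lambda>u v w. elt (of_int u) (of_int v) (of_int w) :: 'k"
  {
    assume "\<exists>u v w. \<bar>(u * c + w * k) * (s * v ^ 2 - r * v * w + q * w ^ 2)\<bar> = 1"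
    then obtain u v w where one: "\<bar>(u * c + w * k) * (s * v ^ 2 - r * v * w + q * w ^ 2)\<bar> = 1"
      by blast
    define N where "N = u * c + w * k"
    define Q where "Q = s * v ^ 2 - r * v * w + q * w ^ 2"
    have "\<bar>N * Q\<bar> = 1" "\<bar>Q * N\<bar> = 1" using one unfolding N_def Q_def
      by (simp_all only: mult.commute)
    from this[THEN abs_zmult_eq_1] have "\<bar>N\<bar> = 1" "\<bar>Q\<bar> = 1" .
    then have NN: "N * N = 1" "Q * Q = 1" by (auto simp: abs_if split: if_splits)
    have gen: "\<exists>h. h \<in> ?A \<and> act h (?z u v w) = ?z m0 m1 m2" for m0 m1 m2
    proof -
      \<comment> \<open>Cramer's rule, with N and Q serving as their own inverses.\<close>
      define S where "S = Q * (s * v * m1 - (r * v - q * w) * m2)"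
      define t where "t = Q * (v * m2 - w * m1)"
      define e where "e = N * (m0 - u * S + 2 * q * v * t)"
      obtain h where h: "order_coords e S t h" using order_coords_exists by blast
      have "v * S + (r * v - q * w) * t = (Q * Q) * m1" "w * S + s * v * t = (Q * Q) * m2"
        unfolding S_def t_def by (simp_all add: Q_def algebra_simps power2_eq_square)
      moreover have "N * e + u * S - 2 * q * v * t = (N * N) * (m0 - u * S + 2 * q * v * t) +
          u * S - 2 * q * v * t"
        unfolding e_def by simp
      ultimately have "act h (?z u v w) = ?z m0 m1 m2"
        unfolding order_coords_act[OF h] N_def[symmetric] NN by simp
      then show ?thesis using h assoc_order_coords by blast
    qed
    show "free_over H act ?A ?O"
      unfolding free_over_def
    proof (rule exI[of _ "{?z u v w}"], intro conjI ballI allI impI)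
      show "{?z u v w} \<subseteq> ?O" unfolding int_adjoin_eq by blast
    next
      fix m assume "m \<in> ?O"
      then obtain m0 m1 m2 where "m = ?z m0 m1 m2" unfolding int_adjoin_eq by blast
      then obtain h where "h \<in> ?A" "act h (?z u v w) = m" using gen by blast
      then show "\<exists>F c. finite F \<and> F \<subseteq> {?z u v w} \<and> c ` F \<subseteq> ?A \<and> m = (\<Sum>b\<in>F. act (c b) b)"
        by (intro exI[of _ "{?z u v w}"] exI[of _ "\<lambda>_. h"]) auto
    next
      fix F C x
      assume F: "finite F \<and> F \<subseteq> {?z u v w} \<and> C ` F \<subseteq> ?A \<and> (\<Sum>b\<in>F. act (C b) b) = 0" and "x \<in> F"
      then have "F = {?z u v w}" "x = ?z u v w" by auto
      then have "C x \<in> ?A" "act (C x) (?z u v w) = 0" using F by auto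
      then obtain e S t where p: "order_coords e S t (C x)" using assoc_order_coords by blast
      from \<open>act (C x) (?z u v w) = 0\<close>[unfolded order_coords_act[OF p], THEN elt_eq_0]
      have z: "N * e + u * S - 2 * q * v * t = 0" "v * S + (r * v - q * w) * t = 0" "w * S +
          s * v * t = 0"
        by (simp_all only: of_int_eq_0_iff N_def)
      have "(s * v) * (v * S + (r * v - q * w) * t) - (r * v - q * w) * (w * S + s * v * t) = Q * S"
        "v * (w * S + s * v * t) - w * (v * S + (r * v - q * w) * t) = Q * t"
        by (simp_all add: Q_def algebra_simps power2_eq_square)
      then have "S = 0" "t = 0" using z(2,3) NN(2) by auto
      moreover from this have "e = 0" using z(1) NN(1) by auto
      ultimately show "C x = \<zero>" using p order_coords_zero by blast
    qed
  }
  assume "free_over H act ?A ?O"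
  then obtain B where B: "B \<subseteq> ?O"
    and spanning: "\<forall>m\<in>?O. \<exists>F C. finite F \<and> F \<subseteq> B \<and> C ` F \<subseteq> ?A \<and> m = (\<Sum>b\<in>F. act (C b) b)"
    and independent: "\<forall>F C. finite F \<and> F \<subseteq> B \<and> C ` F \<subseteq> ?A \<and> (\<Sum>b\<in>F. act (C b) b) = 0 \<longrightarrow>
      (\<forall>b\<in>F. C b = \<zero>)"
    unfolding free_over_def by (elim exE conjE)
  note span = bspec[OF spanning]
  have indep: "\<forall>b\<in>F. C b = \<zero>"
    if "finite F" "F \<subseteq> B" "C ` F \<subseteq> ?A" "(\<Sum>b\<in>F. act (C b) b) = 0" for F C
    using independent[THEN spec, THEN spec, of F C] that by (elim impE) (intro conjI)
  have O: "?z m0 m1 m2 \<in> ?O" for m0 m1 m2 unfolding int_adjoin_eq by blast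
  have "B \<noteq> {}"
  proof
    assume "B = {}"
    then have "?z 1 0 0 = 0" using span[OF O[of 1 0 0]] by auto
    then show False using elt_eq_0 by fastforce
  qed
  then obtain \<theta> where \<theta>: "\<theta> \<in> B" by blast
  then obtain u v w where uvw: "\<theta> = ?z u v w" using B unfolding int_adjoin_eq by blast
  define N where "N = u * c + w * k"
  define Q where "Q = s * v ^ 2 - r * v * w + q * w ^ 2"
  have ker: "e = 0 \<and> S = 0 \<and> t = 0" if "N * e + u * S - 2 * q * v * t = 0" "v * S +
      (r * v - q * w) * t = 0"
    "w * S + s * v * t = 0" for e S t
  proof -
    obtain h where h: "order_coords e S t h" using order_coords_exists by blast
    have "act h \<theta> = 0" unfolding uvw order_coords_act[OF h] N_def[symmetric] that
      by (simp add: elt_simps)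
    moreover have "h \<in> ?A" using h assoc_order_coords by blast
    ultimately have "h = \<zero>" using indep[of "{\<theta>}" "\<lambda>_. h"] \<theta> by auto
    then show ?thesis using order_coords_nonzero[OF h] by blast
  qed
  have "N \<noteq> 0" using ker[of 1 0 0] by auto
  have "Q \<noteq> 0"
  proof
    assume Q: "Q = 0"
    \<comment> \<open>Multiplying (S, t) by N makes the first coordinate equation solvable for an
      integral e, so that \<open>ker\<close> applies.\<close>
    have scaled: "S = 0 \<and> t = 0" if "v * S + (r * v - q * w) * t = 0" "w * S + s * v * t = 0"
      for S t
    proof -
      have "v * (N * S) + (r * v - q * w) * (N * t) = N * (v * S + (r * v - q * w) * t)"
        "w * (N * S) + s * v * (N * t) = N * (w * S + s * v * t)"
        "N * (2 * q * v * t - u * S) + u * (N * S) - 2 * q * v * (N * t) = 0"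
          by (simp_all add: algebra_simps)
      then have "N * S = 0 \<and> N * t = 0"
        unfolding that mult_zero_right using ker by blast
      then show ?thesis using \<open>N \<noteq> 0\<close> by simp
    qed
    \<comment> \<open>The columns of the adjugate of a singular block lie in its kernel, which
      forces v = w = 0; but a zero block also kills (0, 1).\<close>
    have "v * (- (r * v - q * w)) + (r * v - q * w) * v = 0" "w * (- (r * v - q * w)) +
        s * v * v = Q"
      "v * (s * v) + (r * v - q * w) * (- w) = Q" "w * (s * v) + s * v * (- w) = 0"
      by (simp_all add: Q_def algebra_simps power2_eq_square)
    then have "v = 0" "w = 0" using scaled[of "- (r * v - q * w)" v] scaled[of "s * v" "- w"] Q
      by auto
    then show False using scaled[of 0 1] by simp
  qed
  have "B = {\<theta>}"
  proof (rule ccontr)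
    assume "B \<noteq> {\<theta>}"
    then obtain \<theta>' where \<theta>': "\<theta>' \<in> B" "\<theta>' \<noteq> \<theta>" using \<theta> by blast
    then obtain m0 m1 m2 where m: "\<theta>' = ?z m0 m1 m2" using B unfolding int_adjoin_eq by blast
    define S where "S = s * v * m1 - (r * v - q * w) * m2"
    define t where "t = v * m2 - w * m1"
    \<comment> \<open>By Cramer's rule N Q \<theta>' is h \<cdot> \<theta> for some h in the order.
      Together with the scalar -N Q acting on \<theta>' this is a nontrivial relation.\<close>
    obtain h where h: "order_coords (Q * m0 - u * S + 2 * q * v * t) (N * S) (N * t) h"
      using order_coords_exists by blast
    have "v * S + (r * v - q * w) * t = Q * m1" "w * S + s * v * t = Q * m2"
      unfolding S_def t_def Q_def by (simp_all add: algebra_simps power2_eq_square)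
    moreover have "v * (N * S) + (r * v - q * w) * (N * t) = N * (v * S + (r * v - q * w) * t)"
      "w * (N * S) + s * v * (N * t) = N * (w * S + s * v * t)"
      "N * (Q * m0 - u * S + 2 * q * v * t) + u * (N * S) - 2 * q * v * (N * t) = N * (Q * m0)"
      by (simp_all add: algebra_simps)
    ultimately have "v * (N * S) + (r * v - q * w) * (N * t) = N * Q * m1"
      "w * (N * S) + s * v * (N * t) = N * Q * m2"
      "N * (Q * m0 - u * S + 2 * q * v * t) + u * (N * S) - 2 * q * v * (N * t) = N * Q * m0"
      by (simp_all only: mult.assoc)
    then have act1: "act h \<theta> = ?z (N * Q * m0) (N * Q * m1) (N * Q * m2)"
      unfolding uvw order_coords_act[OF h] N_def[symmetric] by (simp only:)
    obtain h' where h': "order_coords 0 (- (N * Q)) 0 h'" using order_coords_exists by blast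
    have act2: "act h' \<theta>' = - ?z (N * Q * m0) (N * Q * m1) (N * Q * m2)"
      unfolding m order_coords_act[OF h'] by (simp add: elt_def of_rat_minus of_rat_mult)
    define C where "C x = (if x = \<theta> then h else h')" for x
    have C: "C \<theta> = h" "C \<theta>' = h'" using \<theta>'(2) by (simp_all add: C_def)
    have "(\<Sum>x\<in>{\<theta>, \<theta>'}. act (C x) x) = act h \<theta> + act h' \<theta>'"
      using \<theta>'(2)[symmetric] by (subst sum.insert) (simp_all add: C)
    also have "\<dots> = 0" unfolding act1 act2 by simp
    finally have sum0: "(\<Sum>x\<in>{\<theta>, \<theta>'}. act (C x) x) = 0" .
    have "h \<in> ?A" "h' \<in> ?A" using h h' assoc_order_coords by blast+
    then have "C ` {\<theta>, \<theta>'} \<subseteq> ?A" using C by simp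
    from indep[OF _ _ this sum0] \<theta> \<theta>'(1) have "C \<theta>' = \<zero>" by blast
    then have "h' = \<zero>" using C by simp
    from order_coords_nonzero[OF h' this] have "N * Q = 0"
      by (elim conjE) (simp only: neg_equal_0_iff_equal)
    then show False using \<open>N \<noteq> 0\<close> \<open>Q \<noteq> 0\<close> by simp
  qed
  have surj: "\<exists>e S t. N * e + u * S - 2 * q * v * t = m0 \<and> v * S + (r * v - q * w) * t = m1 \<and>
      w * S + s * v * t = m2" for m0 m1 m2
  proof -
    obtain F C where F: "finite F" "F \<subseteq> {\<theta>}" "C ` F \<subseteq> ?A" "?z m0 m1 m2 = (\<Sum>b\<in>F. act (C b) b)"
      using span[OF O[of m0 m1 m2]] \<open>B = {\<theta>}\<close> by blast
    have "F = {} \<or> F = {\<theta>}" using F(2) by blast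
    then show ?thesis
    proof
      assume "F = {}"
      then have "?z m0 m1 m2 = 0" using F(4) by simp
      from elt_eq_0[OF this] have "m0 = 0" "m1 = 0" "m2 = 0" by simp_all
      then show ?thesis by (intro exI[of _ 0]) simp
    next
      assume "F = {\<theta>}"
      then have "C \<theta> \<in> ?A" "?z m0 m1 m2 = act (C \<theta>) \<theta>" using F by auto
      then obtain h where "h \<in> ?A" and C: "?z m0 m1 m2 = act h \<theta>" by blast
      then obtain e S t where p: "order_coords e S t h" using assoc_order_coords by blast
      from C[unfolded uvw order_coords_act[OF p] elt_inject of_int_eq_iff, folded N_def]
      show ?thesis by blast
    qed
  qed
  have "Q * S = (s * v) * (v * S + (r * v - q * w) * t) - (r * v - q * w) * (w * S + s * v * t)"
    "Q * t = v * (w * S + s * v * t) - w * (v * S + (r * v - q * w) * t)" for S t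
    by (simp_all add: Q_def algebra_simps power2_eq_square)
  note cramer = this
  obtain e S t where 0: "N * e + u * S - 2 * q * v * t = 1" "v * S + (r * v - q * w) * t = 0"
      "w * S + s * v * t = 0"
    using surj by blast
  have "Q * S = 0" "Q * t = 0"
    using cramer[where S = S and t = t] unfolding 0 by (simp_all only: mult_zero_right diff_self)
  then have "N * e = 1" using 0(1) \<open>Q \<noteq> 0\<close> by simp
  then have N: "\<bar>N\<bar> = 1" by (auto simp: zmult_eq_1_iff)
  \<comment> \<open>Preimages of the last two unit vectors invert the 2 by 2 block, so its
    determinant Q divides 1.\<close>
  obtain S1 t1 where 1: "v * S1 + (r * v - q * w) * t1 = 1" "w * S1 + s * v * t1 = 0" using surj
    by blast
  obtain S2 t2 where 2: "v * S2 + (r * v - q * w) * t2 = 0" "w * S2 + s * v * t2 = 1" using surj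
    by blast
  have "Q * (S1 * t2 - S2 * t1) = (v * S1 + (r * v - q * w) * t1) * (w * S2 + s * v * t2) -
      (v * S2 + (r * v - q * w) * t2) * (w * S1 + s * v * t1)"
    by (simp add: Q_def algebra_simps power2_eq_square)
  then have "Q * (S1 * t2 - S2 * t1) = 1" using 1 2 by simp
  then have "\<bar>Q\<bar> = 1" by (auto simp: zmult_eq_1_iff)
  with N show "\<exists>u v w. \<bar>(u * c + w * k) * (s * v ^ 2 - r * v * w + q * w ^ 2)\<bar> = 1"
    unfolding N_def Q_def abs_mult by (intro exI[of _ u] exI[of _ v] exI[of _ w]) simp
qed

end

section \<open>Arithmetic of the norm form\<close>

text \<open>Everything reduces to n = 2 g gcd(9 b', a' gcd(3, a)). As a' and b' are coprime, the
  remaining gcd is a power of 3.\<close>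

lemma conductor_gcd:
  fixes a b g a' b' :: int
  assumes "g \<ge> 0" "a = g * a'" "b = g * b'" "coprime a' b'"
  defines "n \<equiv> gcd (gcd (18 * b) (6 * a)) (2 * a ^ 2)"
  shows "\<not> 3 dvd a \<Longrightarrow> n = 2 * g" and "3 dvd a \<Longrightarrow> \<not> 3 dvd a' \<Longrightarrow> n = 6 * g" and "3 dvd a' \<Longrightarrow> n = 18 * g"
proof -
  have p3: "prime (3 :: int)" by simp
  have eq: "18 * b = (2 * g) * (9 * b')" "6 * a = (2 * g) * (3 * a')" "2 * a ^ 2 =
      (2 * g) * (a' * a)"
    using assms(2,3) by (simp_all add: power2_eq_square)
  have "gcd (2 * g * x) (2 * g * y) = 2 * g * gcd x y" for x y
    using gcd_mult_left[of "2 * g" x y] assms(1) by (simp add: abs_mult)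
  then have "n = 2 * g * gcd (gcd (9 * b') (3 * a')) (a' * a)"
    unfolding n_def eq by (simp only:)
  also have "gcd (gcd (9 * b') (3 * a')) (a' * a) = gcd (9 * b') (gcd (a' * 3) (a' * a))"
    by (simp add: gcd.assoc mult.commute)
  also have "\<dots> = gcd (9 * b') (a' * gcd 3 a)"
    unfolding gcd_mult_left by simp
  finally have n: "n = 2 * g * gcd (9 * b') (a' * gcd 3 a)" .
  have c3: "coprime 3 a'" if "\<not> 3 dvd a'"
    using p3 that by (simp add: prime_imp_coprime)
  have cop: "coprime (9 * b') a'" if "\<not> 3 dvd a'"
  proof -
    have "coprime (3 * 3) a'" using c3[OF that] by (simp only: coprime_mult_left_iff)
    then show ?thesis using assms(4) by (simp add: coprime_commute)
  qed
  show "n = 2 * g" if "\<not> 3 dvd a"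
  proof -
    have "gcd 3 a = 1" using prime_imp_coprime[OF p3 that] by simp
    moreover have "\<not> 3 dvd a'" using that assms(2) by auto
    ultimately show ?thesis using cop n by simp
  qed
  have g3: "gcd 3 a = 3" if "3 dvd a" using that by (simp add: gcd_proj1_iff)
  show "n = 6 * g" if "3 dvd a" "\<not> 3 dvd a'"
  proof -
    have "coprime (3 * b') a'" using c3[OF that(2)] assms(4) by (simp add: coprime_commute)
    moreover have "gcd (9 * b') (a' * 3) = 3 * gcd (3 * b') a'"
      using gcd_mult_left[of 3 "3 * b'" a'] by (simp add: mult.commute)
    ultimately show ?thesis using n g3[OF that(1)] by simp
  qed
  show "n = 18 * g" if "3 dvd a'"
  proof -
    from that obtain a2 where a2: "a' = 3 * a2" by (auto simp: dvd_def)
    have "coprime b' a2" using assms(4) unfolding a2 by (simp add: coprime_commute)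
    moreover have "gcd (9 * b') (a' * 3) = 9 * gcd b' a2"
      unfolding a2 using gcd_mult_left[of 9 b' a2] by simp
    moreover have "3 dvd a" using assms(2) that by simp
    ultimately show ?thesis using n g3 by simp
  qed
qed

text \<open>Here \<kappa> stands for n / (2 g). Under x = 6 a v - 9 b w, y = w, the divisibility
  condition is integrality of v up to the sign of x, and the condition modulo 3 is solvability of
  the linear factor in u.\<close>

lemma norm_form_iff:
  fixes a b g \<kappa> c k r s q \<Delta> :: int
  assumes a: "a \<noteq> 0" and gk: "g \<noteq> 0" "\<kappa> \<noteq> 0"
    and r: "9 * b = \<kappa> * g * r" and s: "3 * a = \<kappa> * g * s" and q: "a ^ 2 = \<kappa> * g * q"
    and k: "2 * a * c = 3 * k" and c: "c = (if 3 dvd a then 1 else 3)"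
    and \<Delta>: "\<Delta> = 4 * a ^ 3 - 27 * b ^ 2"
  shows "(\<exists>u v w. \<bar>(u * c + w * k) * (s * v ^ 2 - r * v * w + q * w ^ 2)\<bar> = 1) \<longleftrightarrow>
    (\<exists>x y. (x ^ 2 + 3 * \<Delta> * y ^ 2 = 12 * \<kappa> * a * g \<or> x ^ 2 + 3 * \<Delta> * y ^ 2 = - 12 * \<kappa> * a * g) \<and>
      (6 * a dvd 9 * b * y + x \<or> 6 * a dvd 9 * b * y - x) \<and> (\<not> 3 dvd a \<longrightarrow> \<not> 3 dvd y))"
proof -
  have form: "(6 * a * v - 9 * b * w) ^ 2 + 3 * \<Delta> * w ^ 2 =
      12 * \<kappa> * a * g * (s * v ^ 2 - r * v * w + q * w ^ 2)" for v w
  proof -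
    have "(6 * a * v - 9 * b * w) ^ 2 + 3 * \<Delta> * w ^ 2 = 12 * a * (3 * a * v ^ 2 - 9 * b * v * w +
        a ^ 2 * w ^ 2)"
      unfolding \<Delta> by (simp add: algebra_simps power2_eq_square power3_eq_cube)
    also have "\<dots> = 12 * \<kappa> * a * g * (s * v ^ 2 - r * v * w + q * w ^ 2)"
      unfolding r s q by (simp add: algebra_simps)
    finally show ?thesis .
  qed
  show ?thesis
  proof
    assume "\<exists>u v w. \<bar>(u * c + w * k) * (s * v ^ 2 - r * v * w + q * w ^ 2)\<bar> = 1"
    then obtain u v w where one: "\<bar>(u * c + w * k) * (s * v ^ 2 - r * v * w + q * w ^ 2)\<bar> = 1"
      by blast
    define Q where "Q = s * v ^ 2 - r * v * w + q * w ^ 2"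
    have N: "\<bar>u * c + w * k\<bar> = 1" using abs_zmult_eq_1[OF one] .
    have "\<bar>Q\<bar> = 1" using abs_zmult_eq_1 one unfolding Q_def by (metis mult.commute)
    then have "Q = 1 \<or> Q = - 1" by linarith
    then have "(6 * a * v - 9 * b * w) ^ 2 + 3 * \<Delta> * w ^ 2 = 12 * \<kappa> * a * g \<or>
        (6 * a * v - 9 * b * w) ^ 2 + 3 * \<Delta> * w ^ 2 = - 12 * \<kappa> * a * g"
      unfolding form Q_def[symmetric] by auto
    moreover have "6 * a dvd 9 * b * w + (6 * a * v - 9 * b * w)" by simp
    moreover have "\<not> 3 dvd w" if "\<not> 3 dvd a"
    proof
      assume "3 dvd w"
      then have "3 dvd u * c + w * k" using c that by simp
      then have "3 dvd \<bar>u * c + w * k\<bar>" by simp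
      then show False unfolding N by simp
    qed
    ultimately show "\<exists>x y. (x ^ 2 + 3 * \<Delta> * y ^ 2 = 12 * \<kappa> * a * g \<or> x ^ 2 + 3 * \<Delta> * y ^ 2 =
        - 12 * \<kappa> * a * g) \<and>
      (6 * a dvd 9 * b * y + x \<or> 6 * a dvd 9 * b * y - x) \<and> (\<not> 3 dvd a \<longrightarrow> \<not> 3 dvd y)"
      by blast
  next
    assume "\<exists>x y. (x ^ 2 + 3 * \<Delta> * y ^ 2 = 12 * \<kappa> * a * g \<or> x ^ 2 + 3 * \<Delta> * y ^ 2 =
        - 12 * \<kappa> * a * g) \<and>
      (6 * a dvd 9 * b * y + x \<or> 6 * a dvd 9 * b * y - x) \<and> (\<not> 3 dvd a \<longrightarrow> \<not> 3 dvd y)"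
    then obtain x w where eq: "x ^ 2 + 3 * \<Delta> * w ^ 2 = 12 * \<kappa> * a * g \<or> x ^ 2 + 3 * \<Delta> * w ^ 2 =
        - 12 * \<kappa> * a * g"
      and dv: "6 * a dvd 9 * b * w + x \<or> 6 * a dvd 9 * b * w - x" and w: "\<not> 3 dvd a \<longrightarrow> \<not> 3 dvd w"
        by blast
    \<comment> \<open>The norm equation sees only x^2, so either sign of x may be used.\<close>
    obtain v where v: "x = 6 * a * v - 9 * b * w \<or> - x = 6 * a * v - 9 * b * w"
    proof -
      from dv obtain v where "9 * b * w + x = 6 * a * v \<or> 9 * b * w - x = 6 * a * v"
        by (auto simp: dvd_def)
      then have "x = 6 * a * v - 9 * b * w \<or> - x = 6 * a * v - 9 * b * w" by linarith
      then show ?thesis by (rule that)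
    qed
    have "(6 * a * v - 9 * b * w) ^ 2 = x ^ 2" using v by (metis power2_minus)
    with eq form[of v w] have "12 * \<kappa> * a * g * (s * v ^ 2 - r * v * w + q * w ^ 2) =
        (12 * \<kappa> * a * g) * 1 \<or>
        12 * \<kappa> * a * g * (s * v ^ 2 - r * v * w + q * w ^ 2) = (12 * \<kappa> * a * g) * (- 1)" by simp
    moreover have "12 * \<kappa> * a * g \<noteq> 0" using a gk by simp
    ultimately have Q: "s * v ^ 2 - r * v * w + q * w ^ 2 = 1 \<or> s * v ^ 2 - r * v * w +
        q * w ^ 2 = - 1"
      unfolding mult_cancel_left by blast
    \<comment> \<open>If 3 divides a, then c = 1 and u can absorb w k; otherwise c = 3, k = 2a, and
      w k is a unit modulo 3.\<close>
    have "\<exists>u. \<bar>u * c + w * k\<bar> = 1"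
    proof (cases "3 dvd a")
      case True
      then show ?thesis using c by (intro exI[of _ "1 - w * k"]) simp
    next
      case False
      then have "k = 2 * a" using k c by simp
      have "\<not> 3 dvd w * k"
      proof -
        have "\<not> 3 dvd (2 :: int)" by simp
        moreover have "prime (3 :: int)" by simp
        ultimately show ?thesis using w False unfolding \<open>k = 2 * a\<close> by (meson prime_dvd_mult_iff)
      qed
      then have "\<exists>u. w * k + 3 * u = 1 \<or> w * k + 3 * u = - 1" by presburger
      then obtain u where "w * k + 3 * u = 1 \<or> w * k + 3 * u = - 1" ..
      then show ?thesis using c False by (intro exI[of _ u]) (auto simp: algebra_simps)
    qed
    then obtain u where "\<bar>u * c + w * k\<bar> = 1" ..
    then have "\<bar>(u * c + w * k) * (s * v ^ 2 - r * v * w + q * w ^ 2)\<bar> = 1"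
      using Q by (auto simp: abs_mult)
    then show "\<exists>u v w. \<bar>(u * c + w * k) * (s * v ^ 2 - r * v * w + q * w ^ 2)\<bar> = 1" by blast
  qed
qed

text \<open>After division by the common factor g, the prime p divides at most one of a' and b'. The
  case a' = 0 is the infinite valuation of a.\<close>

lemma pval_le_iff:
  fixes a b g a' b' :: int
  assumes "a = g * a'" "b = g * b'" "coprime a' b'" "b \<noteq> 0" "prime p"
  shows "pval p a \<le> pval p b \<longleftrightarrow> \<not> p dvd a'"
proof (cases "a' = 0")
  case True
  then show ?thesis using assms by (simp add: pval_def)
next
  case False
  have nz: "g \<noteq> 0" "b' \<noteq> 0" using assms by auto
  have "prime_elem p" using assms(5) by (rule prime_imp_prime_elem)
  then have m: "multiplicity p a = multiplicity p g + multiplicity p a'"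
    "multiplicity p b = multiplicity p g + multiplicity p b'"
    using assms(1,2) nz False by (simp_all add: prime_elem_multiplicity_mult_distrib)
  have le: "pval p a \<le> pval p b \<longleftrightarrow> multiplicity p a' \<le> multiplicity p b'"
  proof -
    have "a \<noteq> 0" using assms(1) nz False by simp
    then have "pval p a \<le> pval p b \<longleftrightarrow> multiplicity p a \<le> multiplicity p b"
      using assms(4) by (simp add: pval_def)
    then show ?thesis unfolding m by (simp only: add_le_cancel_left)
  qed
  have unit: "\<not> is_unit p" using assms(5) not_prime_unit by blast
  show ?thesis
  proof (cases "p dvd a'")
    case True
    then have "\<not> p dvd b'" using assms(3) unit by (meson coprime_common_divisor)
    then have "multiplicity p b' = 0" by (rule not_dvd_imp_multiplicity_0)
    moreover have "multiplicity p a' > 0" using True False unit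
      by (simp add: multiplicity_gt_zero_iff)
    ultimately show ?thesis using le True by simp
  next
    case False
    then show ?thesis using le by (simp add: not_dvd_imp_multiplicity_0)
  qed
qed

theorem theorem1p1:
  fixes a b \<Delta> g :: int
    and \<alpha> :: "'k::field_char_0"
    and H :: "('h, 'm) hopf_scheme"
    and act :: "'h \<Rightarrow> 'k \<Rightarrow> 'k"
  assumes "\<And>p. prime p \<Longrightarrow> pval p a \<le> 2 \<or> pval p b \<le> 3"
    and "irreducible (map_poly of_int (cubic a b) :: rat poly)"
    and "poly (map_poly of_int (cubic a b)) \<alpha> = 0"
    and "\<Delta> = 4 * a ^ 3 - 27 * b ^ 2"
    and "g = gcd a b"
    and "hopf_galois_structure (rat_adjoin \<alpha>) H act"
  shows "free_over H act (assoc_order H act (int_adjoin \<alpha>)) (int_adjoin \<alpha>) \<longleftrightarrow>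
    (\<exists>x y :: int.
      (\<not> 3 dvd a \<longrightarrow>
         (x ^ 2 + 3 * \<Delta> * y ^ 2 = 12 * a * g \<or> x ^ 2 + 3 * \<Delta> * y ^ 2 = - 12 * a * g) \<and>
         (6 * a dvd 9 * b * y + x \<or> 6 * a dvd 9 * b * y - x) \<and>
         \<not> 3 dvd y) \<and>
      (3 dvd a \<and> pval 3 a \<le> pval 3 b \<longrightarrow>
         (x ^ 2 + 3 * \<Delta> * y ^ 2 = 36 * a * g \<or> x ^ 2 + 3 * \<Delta> * y ^ 2 = - 36 * a * g) \<and>
         (6 * a dvd 9 * b * y + x \<or> 6 * a dvd 9 * b * y - x)) \<and>
      (pval 3 a > pval 3 b \<longrightarrow>
         (x ^ 2 + 3 * \<Delta> * y ^ 2 = 108 * a * g \<or> x ^ 2 + 3 * \<Delta> * y ^ 2 = - 108 * a * g) \<and>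
         (6 * a dvd 9 * b * y + x \<or> 6 * a dvd 9 * b * y - x)))"
  (is "?free \<longleftrightarrow> ?R")
proof -
  interpret hopf_galois_structure "rat_adjoin \<alpha>" H act by (rule assms(6))
  interpret cubic_hopf_galois a b \<alpha> H act
    by unfold_locales (rule assms(2), rule assms(3))
  have g: "g > 0" using b_nonzero by (simp add: assms(5))
  obtain a' b' where ab: "a = g * a'" "b = g * b'" "coprime a' b'"
  proof -
    have "a = g * (a div g)" "b = g * (b div g)" unfolding assms(5) by simp_all
    moreover have "coprime (a div g) (b div g)"
      unfolding assms(5) using b_nonzero by (intro div_gcd_coprime) simp
    ultimately show ?thesis by (rule that)
  qed
  have pv: "pval 3 a \<le> pval 3 b \<longleftrightarrow> \<not> 3 dvd a'"
    by (rule pval_le_iff[OF ab b_nonzero]) simp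
  have pv': "pval 3 b < pval 3 a \<longleftrightarrow> 3 dvd a'" using pv by (simp add: not_le[symmetric])
  have a3: "3 dvd a' \<Longrightarrow> 3 dvd a" using ab(1) by simp
  define n where "n = gcd (gcd (18 * b) (6 * a)) (2 * a ^ 2)"
  have "n dvd 18 * b" "n dvd 6 * a" "n dvd 2 * a ^ 2"
    unfolding n_def by (meson dvd_trans gcd_dvd1 gcd_dvd2)+
  then obtain r s q where rsq: "18 * b = n * r" "6 * a = n * s" "2 * a ^ 2 = n * q"
    by (auto simp: dvd_def)
  define c :: int where "c = (if 3 dvd a then 1 else 3)"
  have "3 dvd 2 * a * c" by (simp add: c_def)
  then obtain k where k: "2 * a * c = 3 * k" by (auto simp: dvd_def)
  interpret cubic_hopf_galois_order a b \<alpha> H act n r s q c k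
    by unfold_locales (fact n_def rsq k c_def)+
  have free: "?free \<longleftrightarrow> (\<exists>u v w. \<bar>(u * c + w * k) * (s * v ^ 2 - r * v * w + q * w ^ 2)\<bar> = 1)"
    by (rule free_over_iff)
  show ?thesis
  proof (cases "a = 0")
    case True
    \<comment> \<open>For a = 0 the quadratic factor is -r v w with r a unit, so v = w = 1 gives a
      generator. On the other side only the third condition applies, and x = y = 0 satisfies
      it.\<close>
    have "n = 18 * \<bar>b\<bar>" unfolding n_def True by simp
    then have "\<bar>18 * b\<bar> = \<bar>18 * \<bar>b\<bar> * r\<bar>" using rsq(1) by simp
    then have "\<bar>r\<bar> = 1" using b_nonzero by (simp add: abs_mult)
    moreover have "s = 0" "q = 0" "c = 1" "k = 0"
      using rsq n_nonzero k True by (auto simp: c_def)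
    ultimately have "\<bar>(1 * c + 1 * k) * (s * 1 ^ 2 - r * 1 * 1 + q * 1 ^ 2)\<bar> = 1" by simp
    then have ?free unfolding free by blast
    moreover have ?R using True ab(1) g pv by (intro exI[of _ 0]) simp
    ultimately show ?thesis by blast
  next
    case False
    note n_cases = conductor_gcd[OF order.strict_implies_order[OF g] ab, folded n_def]
    have key: "?free \<longleftrightarrow> (\<exists>x y. (x ^ 2 + 3 * \<Delta> * y ^ 2 = 12 * \<kappa> * a * g \<or> x ^ 2 + 3 * \<Delta> * y ^ 2 =
        - 12 * \<kappa> * a * g) \<and>
      (6 * a dvd 9 * b * y + x \<or> 6 * a dvd 9 * b * y - x) \<and> (\<not> 3 dvd a \<longrightarrow> \<not> 3 dvd y))"
      if "n = 2 * (\<kappa> * g)" "\<kappa> \<noteq> 0" for \<kappa>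
      unfolding free
      by (rule norm_form_iff[OF False _ that(2) _ _ _ k c_def assms(4)])
        (use g rsq that(1) in \<open>simp_all add: mult.assoc\<close>)
    consider "\<not> 3 dvd a" | "3 dvd a" "\<not> 3 dvd a'" | "3 dvd a'" by blast
    then show ?thesis
    proof cases
      case 1
      then have "\<not> 3 dvd a'" using a3 by blast
      with 1 show ?thesis using key[of 1] n_cases(1) unfolding pv pv' by simp
    next
      case 2
      then show ?thesis using key[of 3] n_cases(2) unfolding pv pv' by simp
    next
      case 3
      then show ?thesis using key[of 9] n_cases(3) a3 unfolding pv pv' by simp
    qed
  qed
qed

end
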